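(* When restricted to acyclic networks, the problem $p$-Vertex-Decomposable-Max-Flow can be solved in time $O\left(n^{f(p)}\right)$ for some computable function $f$.
   Context: A flow network is ${\cal N}=(D,s,t,c)$ with digraph $D$ on $n$ vertices, source $s$, sink $t$ and capacities $c$; all flows are integer valued. A path-flow along an $(s,t)$-path $P$ is a flow equal to some integer $r$ on every arc of $P$ and $0$ elsewhere. The $p$-Vertex-Decomposable-Max-Flow problem: given a flow network ${\cal N}$ and an integer $p$, find the maximum value of a flow $x$ that can be decomposed into at most $p$ pairwise (internally) vertex-disjoint path-flows. A network is acyclic if $D$ is acyclic. *)

theory Defs
  imports "Graph_Theory.Graph_Theory"
begin

section \<open>Flow networks and vertex-decomposable flows\<close>

text \<open>Digraphs are finite, without loops and parallel arcs. The values of flows and of capacities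
  outside the arc set are irrelevant.\<close>

record 'a network =
  dgraph :: "'a pair_pre_digraph"
  source :: 'a
  sink :: 'a
  cap :: "'a \<times> 'a \<Rightarrow> nat"

definition flow_network :: "'a network \<Rightarrow> bool" where
  "flow_network N \<longleftrightarrow>
     pair_digraph (dgraph N) \<and>
     source N \<in> pverts (dgraph N) \<and> sink N \<in> pverts (dgraph N) \<and> source N \<noteq> sink N"

definition acyclic_network :: "'a network \<Rightarrow> bool" where
  "acyclic_network N \<longleftrightarrow> acyclic (parcs (dgraph N))"

definition balance :: "'a network \<Rightarrow> ('a \<times> 'a \<Rightarrow> nat) \<Rightarrow> 'a \<Rightarrow> int" where
  "balance N x v =
     (\<Sum>a \<in> out_arcs (with_proj (dgraph N)) v. int (x a)) -
     (\<Sum>a \<in> in_arcs (with_proj (dgraph N)) v. int (x a))"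

definition is_flow :: "'a network \<Rightarrow> ('a \<times> 'a \<Rightarrow> nat) \<Rightarrow> bool" where
  "is_flow N x \<longleftrightarrow>
     (\<forall>a \<in> parcs (dgraph N). x a \<le> cap N a) \<and>
     (\<forall>v \<in> pverts (dgraph N) - {source N, sink N}. balance N x v = 0)"

definition flow_value :: "'a network \<Rightarrow> ('a \<times> 'a \<Rightarrow> nat) \<Rightarrow> int" where
  "flow_value N x = balance N x (source N)"

definition st_path :: "'a network \<Rightarrow> ('a \<times> 'a) awalk \<Rightarrow> bool" where
  "st_path N P \<longleftrightarrow> pre_digraph.apath (with_proj (dgraph N)) (source N) P (sink N)"

definition internal_verts :: "'a network \<Rightarrow> ('a \<times> 'a) awalk \<Rightarrow> 'a set" where
  "internal_verts N P =
     set (pre_digraph.awalk_verts (with_proj (dgraph N)) (source N) P) - {source N, sink N}"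

definition path_flow_along :: "'a network \<Rightarrow> ('a \<times> 'a) awalk \<Rightarrow> ('a \<times> 'a \<Rightarrow> nat) \<Rightarrow> bool" where
  "path_flow_along N P x \<longleftrightarrow>
     st_path N P \<and> is_flow N x \<and>
     (\<exists>r. \<forall>a \<in> parcs (dgraph N). x a = (if a \<in> set P then r else 0))"

definition vertex_decomposable :: "'a network \<Rightarrow> nat \<Rightarrow> ('a \<times> 'a \<Rightarrow> nat) \<Rightarrow> bool" where
  "vertex_decomposable N p x \<longleftrightarrow>
     (\<exists>q \<le> p. \<exists>(P :: nat \<Rightarrow> ('a \<times> 'a) awalk) (y :: nat \<Rightarrow> 'a \<times> 'a \<Rightarrow> nat).
        (\<forall>i<q. path_flow_along N (P i) (y i)) \<and>
        (\<forall>i<q. \<forall>j<q. i \<noteq> j \<longrightarrow> internal_verts N (P i) \<inter> internal_verts N (P j) = {}) \<and>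
        (\<forall>a \<in> parcs (dgraph N). x a = (\<Sum>i<q. y i a)))"

definition vertex_decomposable_max_flow :: "'a network \<Rightarrow> nat \<Rightarrow> int \<Rightarrow> bool" where
  "vertex_decomposable_max_flow N p m \<longleftrightarrow>
     (\<exists>x. is_flow N x \<and> vertex_decomposable N p x \<and> flow_value N x = m) \<and>
     (\<forall>x. is_flow N x \<and> vertex_decomposable N p x \<longrightarrow> flow_value N x \<le> m)"


section \<open>Unit-cost random access machine programs\<close>

text \<open>
  Since running times are measured in the number of vertices only, and not in the size of the
  capacities, arithmetic on integers has unit cost. The model is the random access machine with
  addition and truncated subtraction (no multiplication or division) and indirect addressing, with
  structured control flow instead of jumps. A machine has registers, which can only be addressed
  directly by the program, and an unbounded memory of cells, which can be addressed indirectly.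
  Every constant, register access, memory access, arithmetic operation, assignment, skip and branch
  costs one step.
\<close>

datatype exp =
    Num nat
  | Reg nat
  | Mem exp
  | Add exp exp
  | Sub exp exp

datatype prog =
    Skip
  | SetReg nat exp
  | SetMem exp exp
  | Seq prog prog
  | If exp prog prog
  | While exp prog

record ram_state =
  reg :: "nat \<Rightarrow> nat"
  mem :: "nat \<Rightarrow> nat"

primrec eval_exp :: "exp \<Rightarrow> ram_state \<Rightarrow> nat" where
  "eval_exp (Num k) \<sigma> = k"
| "eval_exp (Reg r) \<sigma> = reg \<sigma> r"
| "eval_exp (Mem e) \<sigma> = mem \<sigma> (eval_exp e \<sigma>)"
| "eval_exp (Add e1 e2) \<sigma> = eval_exp e1 \<sigma> + eval_exp e2 \<sigma>"
| "eval_exp (Sub e1 e2) \<sigma> = eval_exp e1 \<sigma> - eval_exp e2 \<sigma>"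

primrec exp_cost :: "exp \<Rightarrow> nat" where
  "exp_cost (Num k) = 1"
| "exp_cost (Reg r) = 1"
| "exp_cost (Mem e) = exp_cost e + 1"
| "exp_cost (Add e1 e2) = exp_cost e1 + exp_cost e2 + 1"
| "exp_cost (Sub e1 e2) = exp_cost e1 + exp_cost e2 + 1"

text \<open>\<open>exec c \<sigma> k \<tau>\<close>: started in state \<open>\<sigma>\<close>, the program \<open>c\<close> halts in state \<open>\<tau>\<close> after
  exactly \<open>k\<close> steps. Conditions are true if they evaluate to a nonzero number.\<close>

inductive exec :: "prog \<Rightarrow> ram_state \<Rightarrow> nat \<Rightarrow> ram_state \<Rightarrow> bool" where
  Skip: "exec Skip \<sigma> 1 \<sigma>"
| SetReg: "exec (SetReg r e) \<sigma> (exp_cost e + 1)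
     (\<sigma>\<lparr>reg := (reg \<sigma>)(r := eval_exp e \<sigma>)\<rparr>)"
| SetMem: "exec (SetMem e1 e2) \<sigma> (exp_cost e1 + exp_cost e2 + 1)
     (\<sigma>\<lparr>mem := (mem \<sigma>)(eval_exp e1 \<sigma> := eval_exp e2 \<sigma>)\<rparr>)"
| Seq: "exec c1 \<sigma> k1 \<sigma>' \<Longrightarrow> exec c2 \<sigma>' k2 \<tau> \<Longrightarrow> exec (Seq c1 c2) \<sigma> (k1 + k2) \<tau>"
| IfTrue: "eval_exp e \<sigma> \<noteq> 0 \<Longrightarrow> exec c1 \<sigma> k \<tau> \<Longrightarrow> exec (If e c1 c2) \<sigma> (exp_cost e + 1 + k) \<tau>"
| IfFalse: "eval_exp e \<sigma> = 0 \<Longrightarrow> exec c2 \<sigma> k \<tau> \<Longrightarrow> exec (If e c1 c2) \<sigma> (exp_cost e + 1 + k) \<tau>"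
| WhileFalse: "eval_exp e \<sigma> = 0 \<Longrightarrow> exec (While e c) \<sigma> (exp_cost e + 1) \<sigma>"
| WhileTrue: "eval_exp e \<sigma> \<noteq> 0 \<Longrightarrow> exec c \<sigma> k1 \<sigma>' \<Longrightarrow> exec (While e c) \<sigma>' k2 \<tau> \<Longrightarrow>
     exec (While e c) \<sigma> (exp_cost e + 1 + k1 + k2) \<tau>"

inductive_cases exec_SkipE: "exec Skip \<sigma> k \<tau>"
inductive_cases exec_SetRegE: "exec (SetReg r e) \<sigma> k \<tau>"
inductive_cases exec_SetMemE: "exec (SetMem e1 e2) \<sigma> k \<tau>"
inductive_cases exec_SeqE: "exec (Seq c1 c2) \<sigma> k \<tau>"
inductive_cases exec_IfE: "exec (If e c1 c2) \<sigma> k \<tau>"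
inductive_cases exec_WhileE: "exec (While e c) \<sigma> k \<tau>"

text \<open>Programs are deterministic, so the existence of a halting run describes the unique run.\<close>

lemma exec_deterministic:
  "exec c \<sigma> k \<tau> \<Longrightarrow> exec c \<sigma> k' \<tau>' \<Longrightarrow> k' = k \<and> \<tau>' = \<tau>"
proof (induction arbitrary: k' \<tau>' rule: exec.induct)
  case (Skip \<sigma>)
  from Skip.prems show ?case by (rule exec_SkipE) simp
next
  case (SetReg r e \<sigma>)
  from SetReg.prems show ?case by (rule exec_SetRegE) simp
next
  case (SetMem e1 e2 \<sigma>)
  from SetMem.prems show ?case by (rule exec_SetMemE) simp
next
  case (Seq c1 \<sigma> k1 \<sigma>' c2 k2 \<tau>)
  from Seq.prems obtain l1 \<rho> l2
    where *: "k' = l1 + l2" "exec c1 \<sigma> l1 \<rho>" "exec c2 \<rho> l2 \<tau>'"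
    by (rule exec_SeqE)
  from Seq.IH(1)[OF *(2)] have "l1 = k1" "\<rho> = \<sigma>'" by simp_all
  with *(3) Seq.IH(2) have "l2 = k2 \<and> \<tau>' = \<tau>" by blast
  with *(1) \<open>l1 = k1\<close> show ?case by simp
next
  case (IfTrue e \<sigma> c1 k \<tau> c2)
  from IfTrue.prems IfTrue.hyps(1) obtain l
    where *: "k' = exp_cost e + 1 + l" "exec c1 \<sigma> l \<tau>'"
    by (elim exec_IfE) simp_all
  from IfTrue.IH[OF *(2)] *(1) show ?case by simp
next
  case (IfFalse e \<sigma> c2 k \<tau> c1)
  from IfFalse.prems IfFalse.hyps(1) obtain l
    where *: "k' = exp_cost e + 1 + l" "exec c2 \<sigma> l \<tau>'"
    by (elim exec_IfE) simp_all
  from IfFalse.IH[OF *(2)] *(1) show ?case by simp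
next
  case (WhileFalse e \<sigma> c)
  from WhileFalse.prems show ?case
    by (rule exec_WhileE) (use WhileFalse.hyps in simp_all)
next
  case (WhileTrue e \<sigma> c k1 \<sigma>' k2 \<tau>)
  from WhileTrue.prems obtain l1 \<rho> l2
    where *: "k' = exp_cost e + 1 + l1 + l2" "exec c \<sigma> l1 \<rho>" "exec (While e c) \<rho> l2 \<tau>'"
    by (rule exec_WhileE) (use WhileTrue.hyps(1) in simp_all)
  from WhileTrue.IH(1)[OF *(2)] have "l1 = k1" "\<rho> = \<sigma>'" by simp_all
  with *(3) WhileTrue.IH(2) have "l2 = k2 \<and> \<tau>' = \<tau>" by blast
  with *(1) \<open>l1 = k1\<close> show ?case by simp
qed

definition computable :: "(nat \<Rightarrow> nat) \<Rightarrow> bool" where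
  "computable f \<longleftrightarrow>
     (\<exists>c. \<forall>k. \<exists>l \<tau>. exec c \<lparr>reg = (\<lambda>_. 0)(0 := k), mem = (\<lambda>_. 0)\<rparr> l \<tau> \<and> reg \<tau> 0 = f k)"

text \<open>
  Inputs are networks whose vertices are numbered \<open>0, \<dots>, n - 1\<close>. The registers \<open>0\<close> to \<open>3\<close>
  contain the parameter, \<open>n\<close>, the source and the sink. The memory contains the adjacency matrix
  (cell \<open>i * n + j\<close>), followed by the matrix of the capacities (cell \<open>n * n + i * n + j\<close>). All
  other registers and cells are \<open>0\<close>.
\<close>

definition input_state :: "nat network \<Rightarrow> nat \<Rightarrow> ram_state" where
  "input_state N p =
     (let n = card (pverts (dgraph N));
          arc = (\<lambda>k. (k div n, k mod n))
      in \<lparr>reg = (\<lambda>_. 0)(0 := p, 1 := n, 2 := source N, 3 := sink N),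
          mem = (\<lambda>k.
            if k < n * n then (if arc k \<in> parcs (dgraph N) then 1 else 0)
            else if k < 2 * n * n then
              (if arc (k - n * n) \<in> parcs (dgraph N) then cap N (arc (k - n * n)) else 0)
            else 0)\<rparr>)"

end

theory Submission
  imports Defs
begin

text \<open>
  A path of positive bottleneck other than the arc from \<open>s\<close> to \<open>t\<close> may be assumed to carry the
  capacity of one of its arcs, so all families of at most \<open>p\<close> values are covered by the
  \<open>(n\<^sup>2)\<^sup>p\<close> choices of \<open>p\<close> cells of the capacity matrix. For fixed values \<open>\<theta>\<^sub>i\<close>, disjoint paths are
  found by the pebbling game of Fortune, Hopcroft and Wyllie: \<open>p\<close> pebbles start at \<open>s\<close>, the vertices
  are processed in a topological order, and when \<open>u\<close> is processed, pebble \<open>i\<close> may move from \<open>u\<close> along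
  an arc of capacity at least \<open>\<theta>\<^sub>i\<close> to \<open>t\<close> or to a vertex without a pebble. The paths drawn by the
  pebbles are disjoint, as a new vertex has not been processed yet and has thus been visited by no
  other pebble. The \<open>n\<^sup>p\<close> positions of the pebbles form the table of a dynamic program.

  Only the arc from \<open>s\<close> to \<open>t\<close> can be shared by two internally disjoint paths. It is erased from the
  capacity matrix, and its capacity is added to the value of a trial in which some pebble has
  threshold 0, that is, in which a path is left over.
\<close>

section \<open>Reasoning about programs\<close>

text \<open>In the \<open>While\<close> clause the 2 pays for the failing last test: at most
  \<open>X\<close> iterations with \<open>1 \<le> X\<close> evaluate the condition at most
  \<open>X + 1 \<le> 2 * X\<close> times.\<close>

primrec factor :: "prog \<Rightarrow> nat" where
  "factor Skip = 1"
| "factor (SetReg r e) = exp_cost e + 1"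
| "factor (SetMem e1 e2) = exp_cost e1 + exp_cost e2 + 1"
| "factor (Seq c1 c2) = factor c1 + factor c2"
| "factor (If e c1 c2) = exp_cost e + 1 + factor c1 + factor c2"
| "factor (While e c) = 2 * (exp_cost e + 1) + factor c"

primrec depth :: "prog \<Rightarrow> nat" where
  "depth Skip = 0"
| "depth (SetReg r e) = 0"
| "depth (SetMem e1 e2) = 0"
| "depth (Seq c1 c2) = max (depth c1) (depth c2)"
| "depth (If e c1 c2) = max (depth c1) (depth c2)"
| "depth (While e c) = Suc (depth c)"

text \<open>If every loop makes at most \<open>X\<close> iterations each time it is entered, then the running time is
  at most \<open>factor c * X ^ depth c\<close>, so no time bound needs to be carried through the rules.\<close>

definition run :: "nat \<Rightarrow> prog \<Rightarrow> ram_state \<Rightarrow> (ram_state \<Rightarrow> bool) \<Rightarrow> bool" where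
  "run X c \<sigma> Q \<longleftrightarrow> (\<exists>k \<tau>. exec c \<sigma> k \<tau> \<and> k \<le> factor c * X ^ depth c \<and> Q \<tau>)"

definition setr :: "nat \<Rightarrow> nat \<Rightarrow> ram_state \<Rightarrow> ram_state" where
  "setr r x \<sigma> = \<sigma>\<lparr>reg := (reg \<sigma>)(r := x)\<rparr>"

definition setm :: "nat \<Rightarrow> nat \<Rightarrow> ram_state \<Rightarrow> ram_state" where
  "setm a x \<sigma> = \<sigma>\<lparr>mem := (mem \<sigma>)(a := x)\<rparr>"

lemma reg_mem_set [simp]:
  "reg (setr r x \<sigma>) = (reg \<sigma>)(r := x)" "mem (setr r x \<sigma>) = mem \<sigma>"
  "reg (setm a x \<sigma>) = reg \<sigma>" "mem (setm a x \<sigma>) = (mem \<sigma>)(a := x)"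
  by (simp_all add: setr_def setm_def)

lemma run_mono: "run X c \<sigma> Q \<Longrightarrow> (\<And>\<tau>. Q \<tau> \<Longrightarrow> Q' \<tau>) \<Longrightarrow> run X c \<sigma> Q'"
  unfolding run_def by blast

lemma run_Skip [simp]: "run X Skip \<sigma> Q \<longleftrightarrow> Q \<sigma>"
  unfolding run_def by (auto elim: exec_SkipE intro!: exI exec.Skip)

lemma run_SetReg [simp]: "run X (SetReg r e) \<sigma> Q \<longleftrightarrow> Q (setr r (eval_exp e \<sigma>) \<sigma>)"
  unfolding run_def setr_def
  by (rule iffI; (elim exE conjE exec_SetRegE)?; (intro exI conjI, rule exec.SetReg)?) auto

lemma run_SetMem [simp]:
  "run X (SetMem e1 e2) \<sigma> Q \<longleftrightarrow> Q (setm (eval_exp e1 \<sigma>) (eval_exp e2 \<sigma>) \<sigma>)"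
  unfolding run_def setm_def
  by (rule iffI; (elim exE conjE exec_SetMemE)?; (intro exI conjI, rule exec.SetMem)?) auto

text \<open>Lifts the bound of a component to the depth of the compound program; this is where
  \<open>1 \<le> X\<close> enters.\<close>

lemma power_max_le:
  fixes X :: nat
  assumes "1 \<le> X"
  shows "a * X ^ d \<le> a * X ^ max d e" "a * X ^ d \<le> a * X ^ max e d"
  using assms by (auto intro!: power_increasing)

lemma run_Seq:
  assumes "1 \<le> X" "run X c1 \<sigma> (\<lambda>\<sigma>'. run X c2 \<sigma>' Q)"
  shows "run X (Seq c1 c2) \<sigma> Q"
proof -
  from assms(2) obtain k1 \<sigma>' k2 \<tau> where *: "exec c1 \<sigma> k1 \<sigma>'" "k1 \<le> factor c1 * X ^ depth c1"
    "exec c2 \<sigma>' k2 \<tau>" "k2 \<le> factor c2 * X ^ depth c2" "Q \<tau>"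
    unfolding run_def by blast
  have "k1 + k2 \<le> factor (Seq c1 c2) * X ^ depth (Seq c1 c2)"
    using *(2,4) power_max_le(1)[OF assms(1), of "factor c1" "depth c1" "depth c2"]
      power_max_le(2)[OF assms(1), of "factor c2" "depth c2" "depth c1"]
    unfolding factor.simps depth.simps distrib_right by linarith
  with * show ?thesis unfolding run_def by (meson exec.Seq)
qed

lemma run_If:
  assumes X: "1 \<le> X"
    and "eval_exp e \<sigma> \<noteq> 0 \<Longrightarrow> run X c1 \<sigma> Q" "eval_exp e \<sigma> = 0 \<Longrightarrow> run X c2 \<sigma> Q"
  shows "run X (If e c1 c2) \<sigma> Q"
proof -
  have 1: "exp_cost e + 1 \<le> (exp_cost e + 1) * X ^ max (depth c1) (depth c2)"
    using X by (metis mult.right_neutral mult_le_mono2 one_le_power)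
  show ?thesis
  proof (cases "eval_exp e \<sigma> = 0")
    case True
    with assms(3) obtain k \<tau> where *: "exec c2 \<sigma> k \<tau>" "k \<le> factor c2 * X ^ depth c2" "Q \<tau>"
      unfolding run_def by blast
    have "exp_cost e + 1 + k \<le> factor (If e c1 c2) * X ^ depth (If e c1 c2)"
      using *(2) 1 power_max_le(2)[OF X, of "factor c2" "depth c2" "depth c1"]
      unfolding factor.simps depth.simps distrib_right by linarith
    with * True show ?thesis unfolding run_def by (meson exec.IfFalse)
  next
    case False
    with assms(2) obtain k \<tau> where *: "exec c1 \<sigma> k \<tau>" "k \<le> factor c1 * X ^ depth c1" "Q \<tau>"
      unfolding run_def by blast
    have "exp_cost e + 1 + k \<le> factor (If e c1 c2) * X ^ depth (If e c1 c2)"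
      using *(2) 1 power_max_le(1)[OF X, of "factor c1" "depth c1" "depth c2"]
      unfolding factor.simps depth.simps distrib_right by linarith
    with * False show ?thesis unfolding run_def by (meson exec.IfTrue)
  qed
qed

definition For :: "nat \<Rightarrow> nat \<Rightarrow> prog \<Rightarrow> prog" where
  "For i m c = Seq (SetReg i (Num 0))
     (While (Sub (Reg m) (Reg i)) (Seq c (SetReg i (Add (Reg i) (Num 1)))))"

text \<open>Induction on the number \<open>j\<close> of iterations that are left, so the counter
  stands at \<open>N - j\<close>. The test costs 4 steps, and the final 4 is the failing
  test.\<close>

lemma exec_counting_loop:
  assumes step: "\<And>k \<tau>. k < N \<Longrightarrow> I k \<tau> \<Longrightarrow> reg \<tau> i = k \<Longrightarrow> reg \<tau> m = N \<Longrightarrow>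
      \<exists>l \<tau>'. exec c \<tau> l \<tau>' \<and> l \<le> T \<and> I (Suc k) \<tau>' \<and> reg \<tau>' i = Suc k \<and> reg \<tau>' m = N"
    and "j \<le> N" "I (N - j) \<sigma>" "reg \<sigma> i = N - j" "reg \<sigma> m = N"
  shows "\<exists>k \<tau>. exec (While (Sub (Reg m) (Reg i)) c) \<sigma> k \<tau> \<and> k \<le> j * (4 + T) + 4 \<and>
    I N \<tau> \<and> reg \<tau> i = N \<and> reg \<tau> m = N"
  using assms(2-)
proof (induction j arbitrary: \<sigma>)
  case 0
  then show ?case
    using exec.WhileFalse[of "Sub (Reg m) (Reg i)" \<sigma> c] by (auto intro!: exI)
next
  case (Suc j)
  then have "N - Suc j < N" "Suc (N - Suc j) = N - j" by auto
  with step[of "N - Suc j" \<sigma>] Suc.prems obtain l \<tau> where *: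
    "exec c \<sigma> l \<tau>" "l \<le> T" "I (N - j) \<tau>" "reg \<tau> i = N - j" "reg \<tau> m = N"
    by auto
  from Suc.IH[of \<tau>] * Suc.prems obtain k \<tau>' where **:
    "exec (While (Sub (Reg m) (Reg i)) c) \<tau> k \<tau>'" "k \<le> j * (4 + T) + 4"
    "I N \<tau>' \<and> reg \<tau>' i = N \<and> reg \<tau>' m = N" by auto
  have "exec (While (Sub (Reg m) (Reg i)) c) \<sigma> (exp_cost (Sub (Reg m) (Reg i)) + 1 + l + k) \<tau>'"
    by (rule exec.WhileTrue[OF _ *(1) **(1)]) (use Suc.prems in auto)
  moreover have "exp_cost (Sub (Reg m) (Reg i)) + 1 + l + k \<le> Suc j * (4 + T) + 4"
    using *(2) **(2) by simp
  ultimately show ?case using **(3) by blast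
qed

text \<open>The invariant is required of the state after the increment, because \<open>For\<close>
  appends the increment to the body; the body itself must return counter and limit intact.\<close>

lemma run_For:
  assumes X: "1 \<le> X" and im: "i \<noteq> m" and N: "reg \<sigma> m = N" "N \<le> X"
    and init: "I 0 (setr i 0 \<sigma>)"
    and step: "\<And>k \<tau>. k < N \<Longrightarrow> I k \<tau> \<Longrightarrow> reg \<tau> i = k \<Longrightarrow> reg \<tau> m = N \<Longrightarrow>
      run X c \<tau> (\<lambda>\<tau>'. reg \<tau>' i = k \<and> reg \<tau>' m = N \<and> I (Suc k) (setr i (Suc k) \<tau>'))"
    and fin: "\<And>\<tau>. I N \<tau> \<Longrightarrow> reg \<tau> i = N \<Longrightarrow> Q \<tau>"
  shows "run X (For i m c) \<sigma> Q"
proof -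
  let ?b = "Seq c (SetReg i (Add (Reg i) (Num 1)))"
  let ?T = "factor ?b * X ^ depth ?b"
  have "\<exists>k \<tau>. exec (While (Sub (Reg m) (Reg i)) ?b) (setr i 0 \<sigma>) k \<tau> \<and> k \<le> N * (4 + ?T) + 4 \<and>
    I N \<tau> \<and> reg \<tau> i = N \<and> reg \<tau> m = N"
  proof (rule exec_counting_loop)
    fix k \<tau> assume "k < N" "I k \<tau>" "reg \<tau> i = k" "reg \<tau> m = N"
    from step[OF this]
    have "run X ?b \<tau> (\<lambda>\<tau>'. I (Suc k) \<tau>' \<and> reg \<tau>' i = Suc k \<and> reg \<tau>' m = N)"
      by (intro run_Seq X) (auto elim!: run_mono simp: im im[symmetric])
    then show "\<exists>l \<tau>'. exec ?b \<tau> l \<tau>' \<and> l \<le> ?T \<and> I (Suc k) \<tau>' \<and> reg \<tau>' i = Suc k \<and> reg \<tau>' m = N"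
      unfolding run_def .
  qed (use init im N in auto)
  then obtain k \<tau> where *: "exec (While (Sub (Reg m) (Reg i)) ?b) (setr i 0 \<sigma>) k \<tau>"
    "k \<le> N * (4 + ?T) + 4" "Q \<tau>" using fin by blast
  have "k \<le> X * (4 + ?T) + 4"
    using *(2) N(2) by (meson add_le_mono le_refl mult_le_mono order_trans)
  \<comment> \<open>The 8 is the share of the test in the \<open>While\<close> clause of
    \<open>factor\<close>; it absorbs the cost of all tests, as
    \<open>4 * X + 4 \<le> 8 * X\<close>.\<close>
  also have "\<dots> \<le> (8 + factor ?b) * X ^ Suc (depth ?b)"
  proof -
    have "1 \<le> X ^ Suc (depth ?b)" "X \<le> X ^ Suc (depth ?b)" using X by auto
    moreover have "X * ?T = factor ?b * X ^ Suc (depth ?b)"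
      by (simp only: power_Suc mult_ac)
    ultimately show ?thesis unfolding distrib_left distrib_right by linarith
  qed
  finally have "run X (While (Sub (Reg m) (Reg i)) ?b) (setr i 0 \<sigma>) Q"
    unfolding run_def using *(1,3) by (intro exI[of _ k] exI[of _ \<tau>]) simp
  then show ?thesis unfolding For_def by (intro run_Seq X) simp
qed

section \<open>Arithmetic and memory subroutines\<close>

definition Neq :: "exp \<Rightarrow> exp \<Rightarrow> exp" where
  "Neq e1 e2 = Add (Sub e1 e2) (Sub e2 e1)"

text \<open>One of the two truncated differences is 0, so their sum is the distance of the two
  values.\<close>

lemma eval_Neq [simp]:
  "eval_exp (Neq e1 e2) \<sigma> = 0 \<longleftrightarrow> eval_exp e1 \<sigma> = eval_exp e2 \<sigma>"
  "0 < eval_exp (Neq e1 e2) \<sigma> \<longleftrightarrow> eval_exp e1 \<sigma> \<noteq> eval_exp e2 \<sigma>"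
  by (auto simp: Neq_def)

text \<open>\<open>L\<close> is the first scratch register: it serves as counter, and the product
  ends up in \<open>L + 1\<close>.\<close>

definition Mul :: "nat \<Rightarrow> nat \<Rightarrow> nat \<Rightarrow> prog" where
  "Mul L x y = Seq (SetReg (L + 1) (Num 0))
     (For L y (SetReg (L + 1) (Add (Reg (L + 1)) (Reg x))))"

lemma run_Mul:
  assumes X: "1 \<le> X" and "x < L" "y < L" "reg \<sigma> y \<le> X"
  shows "run X (Mul L x y) \<sigma> (\<lambda>\<tau>. reg \<tau> (L + 1) = reg \<sigma> x * reg \<sigma> y \<and>
    (\<forall>r<L. reg \<tau> r = reg \<sigma> r) \<and> mem \<tau> = mem \<sigma>)"
  unfolding Mul_def
  by (intro run_Seq X, simp,
    rule run_For[OF X, where N = "reg \<sigma> y" and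
      I = "\<lambda>k \<tau>. reg \<tau> (L + 1) = reg \<sigma> x * k \<and> (\<forall>r<L. reg \<tau> r = reg \<sigma> r) \<and> mem \<tau> = mem \<sigma>"])
    (use assms in auto)

definition DivMod :: "nat \<Rightarrow> nat \<Rightarrow> nat \<Rightarrow> prog" where
  "DivMod L x y = Seq (SetReg (L + 1) (Num 0)) (Seq (SetReg (L + 2) (Num 0))
     (For L x (Seq (SetReg (L + 1) (Add (Reg (L + 1)) (Num 1)))
       (If (Neq (Reg (L + 1)) (Reg y)) Skip
         (Seq (SetReg (L + 1) (Num 0)) (SetReg (L + 2) (Add (Reg (L + 2)) (Num 1))))))))"

text \<open>While counting up to the dividend, the remainder is reset and the quotient raised
  whenever the remainder reaches the divisor. A divisor 0 is never reached, in agreement with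
  \<open>k mod 0 = k\<close> and \<open>k div 0 = 0\<close>.\<close>

lemma run_DivMod:
  assumes X: "1 \<le> X" and "x < L" "y < L" "reg \<sigma> x \<le> X"
  shows "run X (DivMod L x y) \<sigma> (\<lambda>\<tau>. reg \<tau> (L + 1) = reg \<sigma> x mod reg \<sigma> y \<and>
    reg \<tau> (L + 2) = reg \<sigma> x div reg \<sigma> y \<and> (\<forall>r<L. reg \<tau> r = reg \<sigma> r) \<and> mem \<tau> = mem \<sigma>)"
  unfolding DivMod_def
  by (intro run_Seq X, simp, intro run_Seq X, simp,
    rule run_For[OF X, where N = "reg \<sigma> x" and
      I = "\<lambda>k \<tau>. reg \<tau> (L + 1) = k mod reg \<sigma> y \<and> reg \<tau> (L + 2) = k div reg \<sigma> y \<and>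
        (\<forall>r<L. reg \<tau> r = reg \<sigma> r) \<and> mem \<tau> = mem \<sigma>"],
    use assms in auto)
    (auto intro!: run_Seq run_If simp: mod_Suc div_Suc)

text \<open>Repeated division yields the digits, least significant first. \<open>L + 1\<close> holds
  the quotient still to be decoded; \<open>L + 3\<close> and \<open>L + 4\<close> are the results of
  \<open>DivMod (L + 2)\<close>.\<close>

definition Decode :: "nat \<Rightarrow> nat \<Rightarrow> nat \<Rightarrow> nat \<Rightarrow> nat \<Rightarrow> prog" where
  "Decode L x b d l = Seq (SetReg (L + 1) (Reg x))
     (For L l (Seq (DivMod (L + 2) (L + 1) b)
       (Seq (SetMem (Add (Reg d) (Reg L)) (Reg (L + 3))) (SetReg (L + 1) (Reg (L + 4))))))"

lemma run_Decode:
  assumes X: "1 \<le> X" and L: "x < L" "b < L" "d < L" "l < L"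
    and bounds: "reg \<sigma> x \<le> X" "reg \<sigma> l \<le> X"
  shows "run X (Decode L x b d l) \<sigma> (\<lambda>\<tau>. (\<forall>r<L. reg \<tau> r = reg \<sigma> r) \<and>
    (\<forall>a. mem \<tau> a = (if reg \<sigma> d \<le> a \<and> a < reg \<sigma> d + reg \<sigma> l
       then reg \<sigma> x div reg \<sigma> b ^ (a - reg \<sigma> d) mod reg \<sigma> b else mem \<sigma> a)))"
  unfolding Decode_def
proof (intro run_Seq X, simp, rule run_For[OF X, where N = "reg \<sigma> l" and
    I = "\<lambda>k \<tau>. (\<forall>r<L. reg \<tau> r = reg \<sigma> r) \<and> reg \<tau> (L + 1) = reg \<sigma> x div reg \<sigma> b ^ k \<and>
    (\<forall>a. mem \<tau> a = (if reg \<sigma> d \<le> a \<and> a < reg \<sigma> d + k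
       then reg \<sigma> x div reg \<sigma> b ^ (a - reg \<sigma> d) mod reg \<sigma> b else mem \<sigma> a))"], goal_cases)
  case (5 k \<tau>)
  have "reg \<sigma> x div reg \<sigma> b ^ k \<le> X"
    using bounds(1) by (meson div_le_dividend order_trans)
  with 5 L show ?case
    by (intro run_Seq X run_mono[OF run_DivMod[OF X]])
      (auto simp: eval_nat_numeral div_mult2_eq mult.commute[of "reg \<sigma> b"])
qed (use L bounds in auto)

definition Clear :: "nat \<Rightarrow> exp \<Rightarrow> nat \<Rightarrow> prog" where
  "Clear L d l = For L l (SetMem (Add d (Reg L)) (Num 0))"

lemma run_Clear:
  assumes X: "1 \<le> X" and L: "l < L" "reg \<sigma> l \<le> X"
    and d: "\<And>\<tau>. \<forall>r<L. reg \<tau> r = reg \<sigma> r \<Longrightarrow> eval_exp d \<tau> = a0"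
  shows "run X (Clear L d l) \<sigma> (\<lambda>\<tau>. (\<forall>r<L. reg \<tau> r = reg \<sigma> r) \<and>
    (\<forall>a. mem \<tau> a = (if a0 \<le> a \<and> a < a0 + reg \<sigma> l then 0 else mem \<sigma> a)))"
  unfolding Clear_def
  by (rule run_For[OF X, where N = "reg \<sigma> l" and
    I = "\<lambda>k \<tau>. (\<forall>r<L. reg \<tau> r = reg \<sigma> r) \<and>
      (\<forall>a. mem \<tau> a = (if a0 \<le> a \<and> a < a0 + k then 0 else mem \<sigma> a))"])
    (use L d in auto)

section \<open>The pebbling game as a functional program\<close>

lemma cell_less:
  fixes n :: nat
  assumes "u < n" "w < n"
  shows "u * n + w < n * n"
proof -
  have "u * n + w < Suc u * n" using assms(2) by simp
  also have "\<dots> \<le> n * n" using assms(1) by (intro mult_le_mono1) simp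
  finally show ?thesis .
qed

locale pebbling =
  fixes n p s t :: nat and W :: "nat \<Rightarrow> nat"
  assumes s: "s < n" and t: "t < n"
begin

definition dig :: "nat \<Rightarrow> nat \<Rightarrow> nat" where
  "dig S j = S div n ^ j mod n"

definition code :: "(nat \<Rightarrow> nat) \<Rightarrow> nat" where
  "code v = (\<Sum>j<p. v j * n ^ j)"

definition shift :: "nat \<Rightarrow> nat \<Rightarrow> nat \<Rightarrow> nat" where
  "shift S i w = S - dig S i * n ^ i + w * n ^ i"

definition free :: "nat \<Rightarrow> nat \<Rightarrow> bool" where
  "free S w \<longleftrightarrow> w = t \<or> (\<forall>j<p. dig S j \<noteq> w)"

definition can_move :: "(nat \<Rightarrow> nat) \<Rightarrow> nat \<Rightarrow> nat \<Rightarrow> nat \<Rightarrow> bool" where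
  "can_move \<theta> i S w \<longleftrightarrow> \<theta> i \<le> W (dig S i * n + w) \<and> free S w"

definition moves :: "(nat \<Rightarrow> nat) \<Rightarrow> nat \<Rightarrow> nat \<Rightarrow> nat \<Rightarrow> nat set" where
  "moves \<theta> i S m = {shift S i w | w. w < m \<and> can_move \<theta> i S w}"

text \<open>The table only grows: the code in which the pebble stays on \<open>u\<close> is kept.
  This does no harm, as such a code still describes a sound position.\<close>

definition advance :: "(nat \<Rightarrow> nat) \<Rightarrow> nat \<Rightarrow> nat \<Rightarrow> nat \<Rightarrow> nat set \<Rightarrow> nat set" where
  "advance \<theta> u i S D = (if S \<in> D \<and> dig S i = u then D \<union> moves \<theta> i S n else D)"

definition process :: "(nat \<Rightarrow> nat) \<Rightarrow> nat \<Rightarrow> nat set \<Rightarrow> nat set" where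
  "process \<theta> u = fold (\<lambda>i. fold (advance \<theta> u i) [0..<n ^ p]) [0..<p]"

definition ready :: "nat set \<Rightarrow> nat \<Rightarrow> bool" where
  "ready F u \<longleftrightarrow> (\<forall>v<n. W (v * n + u) \<noteq> 0 \<longrightarrow> v \<in> F)"

text \<open>One step of Kahn's topological sorting, interleaved with the game. The sink is marked
  but not processed, as pebbles on it remain there.\<close>

definition peel :: "(nat \<Rightarrow> nat) \<Rightarrow> nat \<Rightarrow> nat set \<times> nat set \<Rightarrow> nat set \<times> nat set" where
  "peel \<theta> u FD = (if u \<notin> fst FD \<and> ready (fst FD) u
     then (insert u (fst FD), if u = t then snd FD else process \<theta> u (snd FD)) else FD)"

definition sweeps :: "(nat \<Rightarrow> nat) \<Rightarrow> nat set \<times> nat set" where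
  "sweeps \<theta> = fold (\<lambda>_. fold (peel \<theta>) [0..<n]) [0..<n] ({}, {code (\<lambda>_. s)})"

definition accepts :: "(nat \<Rightarrow> nat) \<Rightarrow> bool" where
  "accepts \<theta> \<longleftrightarrow> code (\<lambda>_. t) \<in> snd (sweeps \<theta>)"

text \<open>The digits of the trial number \<open>T\<close> in base \<open>n * n\<close> are the
  chosen cells of the matrix.\<close>

definition threshold :: "nat \<Rightarrow> nat \<Rightarrow> nat" where
  "threshold T i = W (T div (n * n) ^ i mod (n * n))"

definition total :: "nat \<Rightarrow> (nat \<Rightarrow> nat) \<Rightarrow> nat" where
  "total C \<theta> = (\<Sum>i<p. \<theta> i) + (if \<exists>i<p. \<theta> i = 0 then C else 0)"

definition trial :: "nat \<Rightarrow> nat \<Rightarrow> nat \<Rightarrow> nat" where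
  "trial C T b = (if accepts (threshold T) then max b (total C (threshold T)) else b)"

definition best :: "nat \<Rightarrow> nat" where
  "best C = fold (trial C) [0..<n ^ p * n ^ p] 0"

section \<open>Positional notation for the positions of the pebbles\<close>

lemma dig_less: "dig S j < n"
  using s by (simp add: dig_def)

lemma sum_digits_less: "\<forall>j<k. v j < n \<Longrightarrow> (\<Sum>j<k. v j * n ^ j) < n ^ k"
proof (induction k)
  case (Suc k)
  then have "(\<Sum>j<Suc k. v j * n ^ j) < Suc (v k) * n ^ k" by simp
  also have "\<dots> \<le> n * n ^ k" using Suc.prems by (intro mult_le_mono1) (simp add: Suc_leI)
  finally show ?case by simp
qed simp

lemma code_less: "\<forall>j<p. v j < n \<Longrightarrow> code v < n ^ p"
  unfolding code_def by (rule sum_digits_less)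

text \<open>For \<open>i < k\<close> the top summand divided by \<open>n ^ i\<close> is a multiple
  of \<open>n\<close> and leaves digit \<open>i\<close> alone; for \<open>i = k\<close> the lower
  summands stay below \<open>n ^ k\<close> and vanish in the division.\<close>

lemma dig_sum_digits: "\<forall>j<k. v j < n \<Longrightarrow> i < k \<Longrightarrow> dig (\<Sum>j<k. v j * n ^ j) i = v i"
proof (induction k)
  case (Suc k)
  have n: "n > 0" using s by simp
  have less: "(\<Sum>j<k. v j * n ^ j) < n ^ k" using Suc.prems by (intro sum_digits_less) simp
  show ?case
  proof (cases "i = k")
    case True
    with less Suc.prems show ?thesis by (simp add: dig_def n)
  next
    case False
    with Suc.prems have "i < k" by simp
    have "k = Suc i + (k - Suc i)" using \<open>i < k\<close> by simp
    then have "n ^ k = n ^ Suc i * n ^ (k - Suc i)" by (metis power_add)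
    then have "v k * n ^ k = (v k * n ^ (k - Suc i) * n) * n ^ i" by simp
    then have "((\<Sum>j<k. v j * n ^ j) + v k * n ^ k) div n ^ i =
        v k * n ^ (k - Suc i) * n + (\<Sum>j<k. v j * n ^ j) div n ^ i"
      using n by (simp only:) (simp add: div_mult_self1)
    then show ?thesis using Suc \<open>i < k\<close> by (simp add: dig_def)
  qed
qed simp

lemma dig_code: "\<forall>j<p. v j < n \<Longrightarrow> i < p \<Longrightarrow> dig (code v) i = v i"
  unfolding code_def by (rule dig_sum_digits)

lemma code_dig:
  assumes "S < n ^ p"
  shows "code (dig S) = S"
proof -
  have "(\<Sum>j<k. dig S j * n ^ j) = S mod n ^ k" for k
    by (induction k) (simp_all add: dig_def mod_mult2_eq mult.commute[of n])
  with assms show ?thesis by (simp add: code_def)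
qed

text \<open>The \<open>i\<close>-th summand splits off, so the truncated subtraction is exact. This
  justifies the arithmetic form of \<open>shift\<close>.\<close>

lemma code_upd:
  assumes "i < p"
  shows "code (v(i := w)) = code v - v i * n ^ i + w * n ^ i"
proof -
  have "code u = u i * n ^ i + (\<Sum>j\<in>{..<p} - {i}. u j * n ^ j)" for u
    unfolding code_def using assms by (subst sum.remove[of _ i]) auto
  from this[of v] this[of "v(i := w)"] show ?thesis by simp
qed

lemma shift_eq: "S < n ^ p \<Longrightarrow> i < p \<Longrightarrow> shift S i w = code ((dig S)(i := w))"
  by (simp add: code_upd shift_def code_dig)

lemma shift_less: "S < n ^ p \<Longrightarrow> i < p \<Longrightarrow> w < n \<Longrightarrow> shift S i w < n ^ p"
  by (auto simp: shift_eq dig_less intro: code_less)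

lemma dig_shift:
  "S < n ^ p \<Longrightarrow> i < p \<Longrightarrow> j < p \<Longrightarrow> w < n \<Longrightarrow> dig (shift S i w) j = (if j = i then w else dig S j)"
  by (simp add: shift_eq dig_code dig_less)

end

section \<open>The pebbling game as a program\<close>

text \<open>
  Registers: 0 to 3 hold \<open>p\<close>, \<open>n\<close>, \<open>s\<close>, \<open>t\<close>; 4 to 6 hold \<open>n\<^sup>2\<close>, \<open>n\<^sup>p\<close>, \<open>n\<^bsup>2p\<^esup>\<close>; 7 the capacity of the arc
  from \<open>s\<close> to \<open>t\<close>; 8 the best value so far; 9 to 11 the addresses of the thresholds, of the digits
  of the current code and of the table of reached codes; 12 and 13 the codes of all pebbles on \<open>s\<close>
  and on \<open>t\<close>; 14 the number of the trial; 16 and 17 the summands of its value; 19 the processed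
  vertex \<open>u\<close>; 22 the pebble \<open>i\<close>; 23 \<open>n\<^sup>i\<close>; 24 the code \<open>S\<close>; 26 \<open>u * n\<close>; 28 \<open>u * n\<^sup>i\<close>; 29 the target.
  Every loop and subprogram leaves the registers below its own loop counter unchanged, except for
  register 8 and the setup.

  Arcs of capacity 0 are useless, so the capacity matrix suffices, and the first \<open>n\<close> cells of the
  adjacency matrix are reused to mark the processed vertices.
\<close>

definition Occ :: prog where
  "Occ = Seq (SetReg 31 (Num 0)) (Seq
     (For 30 0 (If (Neq (Mem (Add (Reg 10) (Reg 30))) (Reg 29)) Skip (SetReg 31 (Num 1))))
     (If (Neq (Reg 29) (Reg 3)) Skip (SetReg 31 (Num 0))))"

text \<open>The truncated difference of threshold and capacity is nonzero exactly if the capacity is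
  too small.\<close>

definition Moves :: prog where
  "Moves = For 29 1
     (If (Sub (Mem (Add (Reg 9) (Reg 22))) (Mem (Add (Reg 4) (Add (Reg 26) (Reg 29))))) Skip
       (Seq Occ (If (Reg 31) Skip (Seq (Mul 32 29 23)
         (SetMem (Add (Reg 11) (Add (Sub (Reg 24) (Reg 28)) (Reg 33))) (Num 1))))))"

definition Advance :: prog where
  "Advance = If (Mem (Add (Reg 11) (Reg 24)))
     (Seq (Decode 25 24 1 10 0) (If (Neq (Mem (Add (Reg 10) (Reg 22))) (Reg 19)) Skip
       (Seq (Mul 25 19 1) (Seq (Mul 27 19 23) Moves))))
     Skip"

definition Process :: prog where
  "Process = Seq (SetReg 23 (Num 1))
     (For 22 0 (Seq (For 24 5 Advance) (Seq (Mul 24 23 1) (SetReg 23 (Reg 25)))))"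

definition Ready :: prog where
  "Ready = Seq (SetReg 21 (Num 0)) (For 20 1 (Seq (Mul 22 20 1)
     (If (Mem (Add (Reg 4) (Add (Reg 23) (Reg 19))))
       (If (Mem (Reg 20)) Skip (SetReg 21 (Num 1))) Skip)))"

definition Peel :: prog where
  "Peel = If (Mem (Reg 19)) Skip (Seq Ready (If (Reg 21) Skip
     (Seq (SetMem (Reg 19) (Num 1)) (If (Neq (Reg 19) (Reg 3)) Process Skip))))"

definition Thresholds :: prog where
  "Thresholds = Seq (Decode 15 14 4 9 0) (Seq (SetReg 16 (Num 0)) (Seq (SetReg 17 (Num 0))
     (For 15 0 (Seq (SetMem (Add (Reg 9) (Reg 15)) (Mem (Add (Reg 4) (Mem (Add (Reg 9) (Reg 15))))))
       (Seq (SetReg 16 (Add (Reg 16) (Mem (Add (Reg 9) (Reg 15)))))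
         (If (Mem (Add (Reg 9) (Reg 15))) Skip (SetReg 17 (Reg 7))))))))"

text \<open>Under truncated subtraction the new value \<open>b + (x - b)\<close> of register 8 is
  \<open>max b x\<close>.\<close>

definition Trial :: prog where
  "Trial = Seq Thresholds (Seq (Clear 18 (Num 0) 1) (Seq (Clear 18 (Reg 11) 5)
     (Seq (SetMem (Add (Reg 11) (Reg 12)) (Num 1)) (Seq (For 18 1 (For 19 1 Peel))
       (If (Mem (Add (Reg 11) (Reg 13)))
         (SetReg 8 (Add (Reg 8) (Sub (Add (Reg 16) (Reg 17)) (Reg 8)))) Skip)))))"

definition Codes :: prog where
  "Codes = Seq (SetReg 5 (Num 1)) (Seq (SetReg 12 (Num 0)) (Seq (SetReg 13 (Num 0))
     (For 14 0 (Seq (Mul 15 5 2) (Seq (SetReg 12 (Add (Reg 12) (Reg 16)))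
       (Seq (Mul 15 5 3) (Seq (SetReg 13 (Add (Reg 13) (Reg 16)))
         (Seq (Mul 15 5 1) (SetReg 5 (Reg 16))))))))))"

definition Setup :: prog where
  "Setup = Seq (Mul 14 1 1) (Seq (SetReg 4 (Reg 15)) (Seq (Mul 14 2 1)
     (Seq (SetReg 7 (Mem (Add (Reg 4) (Add (Reg 15) (Reg 3)))))
     (Seq (SetMem (Add (Reg 4) (Add (Reg 15) (Reg 3))) (Num 0))
     (Seq (SetReg 9 (Add (Reg 4) (Reg 4))) (Seq (SetReg 10 (Add (Reg 9) (Reg 0)))
     (Seq (SetReg 11 (Add (Reg 10) (Reg 0))) (Seq Codes
     (Seq (Mul 14 5 5) (Seq (SetReg 6 (Reg 15)) (SetReg 8 (Num 0))))))))))))"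

definition Solve :: prog where
  "Solve = Seq Setup (Seq (For 14 6 Trial) (SetReg 0 (Reg 8)))"

section \<open>Contents of registers and memory during the game\<close>

locale pebbling_run = pebbling +
  fixes X :: nat
  assumes X: "1 \<le> X" "n \<le> X" "p \<le> X" "n ^ p \<le> X" "n ^ p * n ^ p \<le> X"
begin

definition env :: "ram_state \<Rightarrow> bool" where
  "env \<sigma> \<longleftrightarrow> reg \<sigma> 0 = p \<and> reg \<sigma> 1 = n \<and> reg \<sigma> 2 = s \<and> reg \<sigma> 3 = t \<and> reg \<sigma> 4 = n * n \<and>
     reg \<sigma> 5 = n ^ p \<and> reg \<sigma> 6 = n ^ p * n ^ p \<and> reg \<sigma> 9 = 2 * (n * n) \<and>
     reg \<sigma> 10 = 2 * (n * n) + p \<and> reg \<sigma> 11 = 2 * (n * n) + 2 * p \<and>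
     reg \<sigma> 12 = code (\<lambda>_. s) \<and> reg \<sigma> 13 = code (\<lambda>_. t)"

definition weights :: "ram_state \<Rightarrow> bool" where
  "weights \<sigma> \<longleftrightarrow> (\<forall>c<n * n. mem \<sigma> (n * n + c) = W c)"

text \<open>The \<open>p\<close> digit cells between thresholds and table are left out on purpose,
  since \<open>Decode\<close> overwrites them during the game.\<close>

definition rep :: "(nat \<Rightarrow> nat) \<Rightarrow> nat set \<Rightarrow> nat set \<Rightarrow> ram_state \<Rightarrow> bool" where
  "rep \<theta> F D \<sigma> \<longleftrightarrow> weights \<sigma> \<and> (\<forall>i<p. mem \<sigma> (2 * (n * n) + i) = \<theta> i) \<and>
     (\<forall>u<n. mem \<sigma> u = of_bool (u \<in> F)) \<and>
     (\<forall>S<n ^ p. mem \<sigma> (2 * (n * n) + 2 * p + S) = of_bool (S \<in> D))"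

lemma env_cong: "env \<sigma> \<Longrightarrow> \<forall>r<14. r \<noteq> 8 \<longrightarrow> reg \<tau> r = reg \<sigma> r \<Longrightarrow> env \<tau>"
  by (simp add: env_def)

text \<open>\<open>Decode\<close> writes only into the digit cells, which are disjoint from
  everything that \<open>rep\<close> speaks of; the marks lie below them since
  \<open>u < n \<le> n * n\<close>.\<close>

lemma rep_cong:
  assumes "rep \<theta> F D \<sigma>"
    "\<forall>a. \<not> (2 * (n * n) + p \<le> a \<and> a < 2 * (n * n) + p + p) \<longrightarrow> mem \<tau> a = mem \<sigma> a"
  shows "rep \<theta> F D \<tau>"
proof -
  have "\<not> 2 * (n * n) + p \<le> u" if "u < n" for u
    using that le_square[of n] by linarith
  with assms show ?thesis by (simp add: rep_def weights_def)
qed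

lemma rep_setr [simp]: "rep \<theta> F D (setr r x \<sigma>) = rep \<theta> F D \<sigma>"
  by (simp add: rep_def weights_def)

lemma weights_setr [simp]: "weights (setr r x \<sigma>) = weights \<sigma>"
  by (simp add: weights_def)

lemma rep_mem_eq: "rep \<theta> F D \<sigma> \<Longrightarrow> mem \<tau> = mem \<sigma> \<Longrightarrow> rep \<theta> F D \<tau>"
  by (simp add: rep_def weights_def)

lemma rep_insert_code:
  assumes "rep \<theta> F D \<sigma>"
  shows "rep \<theta> F (insert S D) (setm (2 * (n * n) + 2 * p + S) 1 \<sigma>)"
proof -
  have "u \<noteq> 2 * (n * n) + 2 * p + S" if "u < n" for u
    using that le_square[of n] by linarith
  with assms show ?thesis by (auto simp: rep_def weights_def)
qed

lemma rep_insert_vertex: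
  assumes "rep \<theta> F D \<sigma>" "u < n"
  shows "rep \<theta> (insert u F) D (setm u 1 \<sigma>)"
proof -
  have "u < n * n" using assms(2) le_square[of n] by linarith
  with assms show ?thesis by (auto simp: rep_def weights_def)
qed

lemma power_le_X: "i \<le> p \<Longrightarrow> n ^ i \<le> X"
  using X(4) s power_increasing[of i p n] by linarith

section \<open>Runs of the subprograms\<close>

lemma run_Occ:
  assumes "env \<sigma>" "\<forall>j<p. mem \<sigma> (2 * (n * n) + p + j) = dig S j"
  shows "run X Occ \<sigma> (\<lambda>\<tau>. (reg \<tau> 31 = 0 \<longleftrightarrow> free S (reg \<sigma> 29)) \<and>
    (\<forall>r<30. reg \<tau> r = reg \<sigma> r) \<and> mem \<tau> = mem \<sigma>)"
  unfolding Occ_def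
  by (intro run_Seq X, simp, intro run_Seq X,
    rule run_For[OF X(1), where N = p and I = "\<lambda>k \<tau>. (reg \<tau> 31 = 0 \<longleftrightarrow> (\<forall>j<k. dig S j \<noteq> reg \<sigma> 29)) \<and>
      (\<forall>r<30. reg \<tau> r = reg \<sigma> r) \<and> mem \<tau> = mem \<sigma>"])
    (use assms X in \<open>auto intro!: run_If simp: env_def free_def less_Suc_eq\<close>)

lemma run_Moves:
  assumes e: "env \<sigma>" and r: "rep \<theta> F D \<sigma>"
    and pos: "\<forall>j<p. mem \<sigma> (2 * (n * n) + p + j) = dig S j"
    and i: "i < p" and S: "S < n ^ p"
    and regs: "reg \<sigma> 22 = i" "reg \<sigma> 23 = n ^ i" "reg \<sigma> 24 = S" "reg \<sigma> 26 = dig S i * n"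
      "reg \<sigma> 28 = dig S i * n ^ i"
  shows "run X Moves \<sigma> (\<lambda>\<tau>. rep \<theta> F (D \<union> moves \<theta> i S n) \<tau> \<and> (\<forall>r<29. reg \<tau> r = reg \<sigma> r))"
  unfolding Moves_def
\<comment> \<open>The digit cells belong to the invariant because \<open>Occ\<close> reads them and
  \<open>rep\<close> says nothing about them.\<close>
proof (rule run_For[OF X(1), where N = n and I = "\<lambda>k \<tau>. rep \<theta> F (D \<union> moves \<theta> i S k) \<tau> \<and>
    (\<forall>r<29. reg \<tau> r = reg \<sigma> r) \<and> (\<forall>j<p. mem \<tau> (2 * (n * n) + p + j) = dig S j)"], goal_cases)
  case (5 w \<tau>)
  then have e': "env \<tau>" by (intro env_cong[OF e]) simp
  have cell: "dig S i * n + w < n * n" using 5(1) dig_less by (rule cell_less[rotated])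
  have "{shift S i w' | w'. w' < Suc w \<and> can_move \<theta> i S w'} =
    moves \<theta> i S w \<union> (if can_move \<theta> i S w then {shift S i w} else {})"
    by (auto simp: moves_def less_Suc_eq)
  then have step: "D \<union> moves \<theta> i S (Suc w) =
      (if can_move \<theta> i S w then insert (shift S i w) (D \<union> moves \<theta> i S w) else D \<union> moves \<theta> i S w)"
    by (auto simp: moves_def)
  have W: "mem \<tau> (n * n + (dig S i * n + w)) = W (dig S i * n + w)"
    and th: "mem \<tau> (2 * (n * n) + i) = \<theta> i"
    using 5 cell i by (auto simp: rep_def weights_def)
  show ?case
  proof (rule run_If[OF X(1)], goal_cases)
    case 1
    with 5 e' W th regs step show ?case
      by (auto simp: env_def can_move_def rep_def weights_def)
  next
    case 2
    with 5 e' W th regs have le: "\<theta> i \<le> W (dig S i * n + w)" by (simp add: env_def)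
    show ?case
      apply (intro run_Seq X run_mono[OF run_Occ[of \<tau> S]] e')
      subgoal using 5 by simp
      apply (intro run_If X)
      subgoal for \<tau>1 using 5 step rep_mem_eq[of \<theta> F "D \<union> moves \<theta> i S w" \<tau> \<tau>1]
          by (simp add: can_move_def)
      apply (intro run_Seq X run_mono[OF run_Mul] X(1))
      subgoal by simp
      subgoal by simp
      subgoal using regs 5 power_le_X[of i] i by simp
      subgoal premises prems for \<tau>1 \<tau>2
      proof -
        have 1: "can_move \<theta> i S w" using prems 5 le by (simp add: can_move_def)
        have 2: "eval_exp (Add (Reg 11) (Add (Sub (Reg 24) (Reg 28)) (Reg 33))) \<tau>2
            = 2 * (n * n) + 2 * p + shift S i w"
          using prems 5 e' regs by (simp add: env_def shift_def)
        have 3: "rep \<theta> F (D \<union> moves \<theta> i S w) \<tau>2" by (rule rep_mem_eq[of _ _ _ \<tau>]) (use prems 5 in auto)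
        show ?thesis
          unfolding run_SetMem 2 step using 1 rep_insert_code[OF 3, of "shift S i w"] prems 5
          by simp
      qed
      done
  qed
qed (use e r pos X in \<open>auto simp: env_def moves_def rep_def weights_def\<close>)

lemma run_Advance:
  assumes e: "env \<sigma>" and r: "rep \<theta> F D \<sigma>" and i: "i < p" and S: "S < n ^ p" and u: "u < n"
    and regs: "reg \<sigma> 19 = u" "reg \<sigma> 22 = i" "reg \<sigma> 23 = n ^ i" "reg \<sigma> 24 = S"
  shows "run X Advance \<sigma> (\<lambda>\<tau>. rep \<theta> F (advance \<theta> u i S D) \<tau> \<and> (\<forall>r<25. reg \<tau> r = reg \<sigma> r))"
  unfolding Advance_def
proof (rule run_If[OF X(1)], goal_cases)
  case 1
  with e r S regs have D: "S \<in> D" by (simp add: env_def rep_def)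
  show ?case
  proof (rule run_Seq[OF X(1)], rule run_mono[OF run_Decode[OF X(1)]], goal_cases)
    case (7 \<tau>)
    have e': "env \<tau>" by (rule env_cong[OF e]) (use 7 in simp)
    have r': "rep \<theta> F D \<tau>" by (rule rep_cong[OF r]) (use 7 e in \<open>simp add: env_def\<close>)
    have pos: "\<forall>j<p. mem \<tau> (2 * (n * n) + p + j) = dig S j"
      using 7 e regs by (simp add: env_def dig_def)
    show ?case
    proof (rule run_If[OF X(1)], goal_cases)
      case 1
      with e' pos i regs 7 r' D show ?case by (simp add: env_def advance_def)
    next
      case 2
      with e' pos i regs 7 have u: "dig S i = u" by (simp add: env_def)
      show ?case
        apply (intro run_Seq X run_mono[OF run_Mul] X(1))
        subgoal by simp
        subgoal by simp
        subgoal using e' X by (simp add: env_def)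
        subgoal by simp
        subgoal by simp
        subgoal using regs 7 power_le_X[of i] i by simp
        subgoal premises prems for \<tau>1 \<tau>2
          apply (rule run_mono[OF run_Moves[of _ \<theta> F D S i]])
          subgoal by (rule env_cong[OF e']) (use prems in simp)
          subgoal by (rule rep_mem_eq[OF r']) (use prems in simp)
          subgoal using pos prems by simp
          subgoal by (rule i)
          subgoal by (rule S)
          using regs u prems 7 D e' by (simp_all add: advance_def env_def)
        done
    qed
  qed (use regs S e X in \<open>simp_all add: env_def\<close>)
next
  case 2
  with e r S regs show ?case by (simp add: env_def rep_def advance_def)
qed

lemma run_Process:
  assumes e: "env \<sigma>" and r: "rep \<theta> F D \<sigma>" and u: "u < n" and regs: "reg \<sigma> 19 = u"
  shows "run X Process \<sigma> (\<lambda>\<tau>. rep \<theta> F (process \<theta> u D) \<tau> \<and> (\<forall>r<22. reg \<tau> r = reg \<sigma> r))"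
  unfolding Process_def
proof (intro run_Seq X, simp, rule run_For[OF X(1), where N = p and
    I = "\<lambda>k \<tau>. rep \<theta> F (fold (\<lambda>i. fold (advance \<theta> u i) [0..<n ^ p]) [0..<k] D) \<tau> \<and>
      (\<forall>r<22. reg \<tau> r = reg \<sigma> r) \<and> reg \<tau> 23 = n ^ k"], goal_cases)
  case (5 i \<tau>)
  then have e': "env \<tau>" by (intro env_cong[OF e]) simp
  let ?D = "fold (\<lambda>i. fold (advance \<theta> u i) [0..<n ^ p]) [0..<i] D"
  have "run X (For 24 5 Advance) \<tau> (\<lambda>\<tau>'. rep \<theta> F (fold (advance \<theta> u i) [0..<n ^ p] ?D) \<tau>' \<and>
      (\<forall>r<24. reg \<tau>' r = reg \<tau> r))"
  proof (rule run_For[OF X(1), where N = "n ^ p" and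
      I = "\<lambda>k \<tau>'. rep \<theta> F (fold (advance \<theta> u i) [0..<k] ?D) \<tau>' \<and> (\<forall>r<24. reg \<tau>' r = reg \<tau> r)"],
      goal_cases)
    case (5 S \<tau>')
    note outer = \<open>i < p\<close> \<open>reg \<tau> 22 = i\<close> \<open>_ \<and> (\<forall>r<22. reg \<tau> r = reg \<sigma> r) \<and> reg \<tau> 23 = n ^ i\<close>
    have "env \<tau>'" by (rule env_cong[OF e']) (use 5 in simp)
    then show ?case using 5 outer regs u
      by (intro run_mono[OF run_Advance[where u = u and i = i and S = S]])
        (auto simp: rep_def weights_def env_def)
  qed (use 5 e' X in \<open>auto simp: env_def rep_def weights_def\<close>)
  then show ?case
    apply (rule run_Seq[OF X(1) run_mono])
    subgoal for \<tau>'
      using 5 e' X by (intro run_Seq X run_mono[OF run_Mul]) (auto simp: env_def rep_def weights_def)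
    done
qed (use e r X in \<open>auto simp: process_def env_def rep_def weights_def\<close>)

lemma run_Ready:
  assumes e: "env \<sigma>" and r: "rep \<theta> F D \<sigma>" and u: "reg \<sigma> 19 = u" "u < n"
  shows "run X Ready \<sigma> (\<lambda>\<tau>. (reg \<tau> 21 = 0 \<longleftrightarrow> ready F u) \<and>
    (\<forall>r<20. reg \<tau> r = reg \<sigma> r) \<and> mem \<tau> = mem \<sigma>)"
  unfolding Ready_def
proof (intro run_Seq X, simp, rule run_For[OF X(1), where N = n and
    I = "\<lambda>k \<tau>. (reg \<tau> 21 = 0 \<longleftrightarrow> (\<forall>v<k. W (v * n + u) \<noteq> 0 \<longrightarrow> v \<in> F)) \<and>
      (\<forall>r<20. reg \<tau> r = reg \<sigma> r) \<and> mem \<tau> = mem \<sigma>"], goal_cases)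
  case (5 v \<tau>)
  then have e': "env \<tau>" by (intro env_cong[OF e]) simp
  have *: "mem \<sigma> (n * n + (v * n + u)) = W (v * n + u)" "mem \<sigma> v = of_bool (v \<in> F)"
    using r cell_less[OF 5(1) u(2)] 5(1) by (auto simp: rep_def weights_def)
  show ?case
    apply (intro run_Seq X run_mono[OF run_Mul])
    subgoal by simp
    subgoal by simp
    subgoal using e' X by (simp add: env_def)
    subgoal for \<tau>'
      using 5 e' u * by (intro run_If X) (auto simp: env_def less_Suc_eq)
    done
qed (use e X in \<open>auto simp: ready_def env_def\<close>)

lemma run_Peel:
  assumes e: "env \<sigma>" and r: "rep \<theta> (fst FD) (snd FD) \<sigma>" and u: "reg \<sigma> 19 = u" "u < n"
  shows "run X Peel \<sigma> (\<lambda>\<tau>. rep \<theta> (fst (peel \<theta> u FD)) (snd (peel \<theta> u FD)) \<tau> \<and>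
    (\<forall>r<20. reg \<tau> r = reg \<sigma> r))"
  unfolding Peel_def
proof (rule run_If[OF X(1)], goal_cases)
  case 1
  with r u show ?case by (simp add: rep_def peel_def)
next
  case 2
  with r u have F: "u \<notin> fst FD" by (simp add: rep_def)
  show ?case
  proof (rule run_Seq[OF X(1)], rule run_mono[OF run_Ready[OF e r u]], rule run_If[OF X(1)], goal_cases)
    case (1 \<tau>)
    with F rep_mem_eq[OF r, of \<tau>] show ?case by (simp add: peel_def)
  next
    case (2 \<tau>)
    have r': "rep \<theta> (insert u (fst FD)) (snd FD) (setm u 1 \<tau>)"
      by (intro rep_insert_vertex rep_mem_eq[OF r] u(2)) (use 2 in simp)
    have e': "env (setm u 1 \<tau>)" by (rule env_cong[OF e]) (use 2 in simp)
    have t: "reg \<tau> 3 = t" using e 2 by (simp add: env_def)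
    have peel: "peel \<theta> u FD = (insert u (fst FD), if u = t then snd FD else process \<theta> u (snd FD))"
      using F 2 by (simp add: peel_def)
    show ?case
    proof (rule run_Seq[OF X(1)], unfold run_SetMem, rule run_If[OF X(1)], goal_cases)
      case 1
      with 2 u t have "u \<noteq> t" by simp
      have *: "setm (eval_exp (Reg 19) \<tau>) (eval_exp (Num 1) \<tau>) \<tau> = setm u 1 \<tau>" using 2 u by simp
      show ?case
        unfolding * by (rule run_mono[OF run_Process[OF e' r' u(2)]])
          (use 2 u \<open>u \<noteq> t\<close> peel in simp_all)
    next
      case 2
      with \<open>_ \<and> (\<forall>r<20. reg \<tau> r = reg \<sigma> r) \<and> _\<close> u t r' peel show ?case by simp
    qed
  qed
qed

lemma run_sweeps:
  assumes e: "env \<sigma>" and r: "rep \<theta> {} {code (\<lambda>_. s)} \<sigma>"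
  shows "run X (For 18 1 (For 19 1 Peel)) \<sigma> (\<lambda>\<tau>. rep \<theta> (fst (sweeps \<theta>)) (snd (sweeps \<theta>)) \<tau> \<and>
    (\<forall>r<18. reg \<tau> r = reg \<sigma> r))"
\<comment> \<open>The existential quantifier merely names the fold, of which both components are
  needed.\<close>
proof (rule run_For[OF X(1), where N = n and I = "\<lambda>k \<tau>.
    (\<exists>FD. FD = fold (\<lambda>_. fold (peel \<theta>) [0..<n]) [0..<k] ({}, {code (\<lambda>_. s)}) \<and>
      rep \<theta> (fst FD) (snd FD) \<tau>) \<and> (\<forall>r<18. reg \<tau> r = reg \<sigma> r)"], goal_cases)
  case (5 k \<tau>)
  have e': "env \<tau>" by (rule env_cong[OF e]) (use 5 in simp)
  define FD where "FD = fold (\<lambda>_. fold (peel \<theta>) [0..<n]) [0..<k] ({}, {code (\<lambda>_. s)})"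
  have r': "rep \<theta> (fst FD) (snd FD) \<tau>" using 5 by (simp add: FD_def)
  show ?case
  proof (rule run_For[OF X(1), where N = n and I = "\<lambda>k \<tau>'.
      (\<exists>FD'. FD' = fold (peel \<theta>) [0..<k] FD \<and> rep \<theta> (fst FD') (snd FD') \<tau>') \<and>
      (\<forall>r<19. reg \<tau>' r = reg \<tau> r)"], goal_cases)
    case (5 u \<tau>')
    then have r'': "rep \<theta> (fst (fold (peel \<theta>) [0..<u] FD)) (snd (fold (peel \<theta>) [0..<u] FD)) \<tau>'"
      by simp
    have e'': "env \<tau>'" by (rule env_cong[OF e']) (use 5 in simp)
    show ?case by (rule run_mono[OF run_Peel[OF e'' r'' 5(3) 5(1)]]) (use 5 in simp)
  next
    case (6 \<tau>')
    with 5 show ?case by (simp add: FD_def[symmetric])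
  qed (use e' r' X in \<open>simp_all add: env_def\<close>)
next
  case (6 \<tau>)
  then show ?case by (simp add: sweeps_def)
qed (use e r X in \<open>simp_all add: env_def\<close>)

text \<open>The digits are replaced in place: before its iteration a cell holds the index of a
  matrix cell, afterwards the capacity found there. Register 17 receives the capacity of the erased
  arc as soon as a threshold is 0.\<close>

lemma run_Thresholds:
  assumes e: "env \<sigma>" and w: "weights \<sigma>" and T: "reg \<sigma> 14 = T" "T < n ^ p * n ^ p"
  shows "run X Thresholds \<sigma> (\<lambda>\<tau>. weights \<tau> \<and> (\<forall>i<p. mem \<tau> (2 * (n * n) + i) = threshold T i) \<and>
    reg \<tau> 16 + reg \<tau> 17 = total (reg \<sigma> 7) (threshold T) \<and> (\<forall>r<15. reg \<tau> r = reg \<sigma> r))"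
  unfolding Thresholds_def
proof (rule run_Seq[OF X(1)], rule run_mono[OF run_Decode[OF X(1)]], goal_cases)
  case (7 \<tau>)
  let ?c = "\<lambda>i. T div (n * n) ^ i mod (n * n)"
  have e': "env \<tau>" by (rule env_cong[OF e]) (use 7 in simp)
  have init: "weights \<tau>" "\<forall>i<p. mem \<tau> (2 * (n * n) + i) = ?c i"
    using 7 w e T by (simp_all add: weights_def env_def)
  show ?case
  proof (intro run_Seq X(1), unfold run_SetReg, intro run_Seq X(1), unfold run_SetReg,
      rule run_For[OF X(1), where N = p and I = "\<lambda>k \<rho>. weights \<rho> \<and>
      (\<forall>i<p. mem \<rho> (2 * (n * n) + i) = (if i < k then threshold T i else ?c i)) \<and>
      reg \<rho> 16 = (\<Sum>i<k. threshold T i) \<and>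
      reg \<rho> 17 = (if \<exists>i<k. threshold T i = 0 then reg \<sigma> 7 else 0) \<and>
      (\<forall>r<15. reg \<rho> r = reg \<sigma> r)"], goal_cases)
    case (5 k \<rho>)
    have "env \<rho>" by (rule env_cong[OF e]) (use 5 in simp)
    moreover have "?c k < n * n" using s by simp
    moreover from this have "mem \<rho> (n * n + ?c k) = threshold T k"
      using 5 by (simp add: weights_def threshold_def)
    ultimately show ?case using 5
      by (intro run_Seq X(1), unfold run_SetMem run_SetReg, intro run_Seq X(1), unfold run_SetReg,
          intro run_If X(1))
        (simp_all add: env_def weights_def less_Suc_eq, fastforce+)
  qed (use 7 e e' init X in \<open>simp_all add: env_def total_def weights_def\<close>)
qed (use e T X in \<open>simp_all add: env_def\<close>)

lemma run_Trial:
  assumes e: "env \<sigma>" and w: "weights \<sigma>" and T: "reg \<sigma> 14 = T" "T < n ^ p * n ^ p"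
  shows "run X Trial \<sigma> (\<lambda>\<tau>. weights \<tau> \<and> reg \<tau> 8 = trial (reg \<sigma> 7) T (reg \<sigma> 8) \<and>
    (\<forall>r<15. r \<noteq> 8 \<longrightarrow> reg \<tau> r = reg \<sigma> r))"
  unfolding Trial_def
proof (rule run_Seq[OF X(1)], rule run_mono[OF run_Thresholds[OF e w T]], goal_cases)
  case (1 \<tau>1)
  have e1: "env \<tau>1" by (rule env_cong[OF e]) (use 1 in simp)
  show ?case
  proof (rule run_Seq[OF X(1)], rule run_mono[OF run_Clear[OF X(1), where ?a0.0 = 0]], goal_cases)
    case (4 \<tau>2)
    have e2: "env \<tau>2" by (rule env_cong[OF e1]) (use 4 in simp)
    show ?case
    proof (rule run_Seq[OF X(1)], rule run_mono[OF run_Clear[OF X(1), where ?a0.0 = "reg \<tau>2 11"]],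
        goal_cases)
      case (4 \<tau>3)
      note 2 = \<open>_ \<and> (\<forall>a. mem \<tau>2 a = _ a)\<close>
      have e3: "env \<tau>3" by (rule env_cong[OF e2]) (use 4 in simp)
      \<comment> \<open>The marks occupy the cells below \<open>n\<close>, so clearing them spares
        weights and thresholds, and clearing the table spares the marks.\<close>
      have "\<not> n * n + c < n" for c using le_square[of n] by linarith
      moreover have "\<not> 2 * (n * n) + c < n" for c using le_square[of n] by linarith
      moreover have "\<not> 2 * (n * n) + 2 * p \<le> u" if "u < n" for u
        using that le_square[of n] by linarith
      ultimately have "rep (threshold T) {} {} \<tau>3"
        using 4 2 1 e1 e2 e3 by (simp add: rep_def weights_def env_def)
      from rep_insert_code[OF this, of "code (\<lambda>_. s)"]
      have r: "rep (threshold T) {} {code (\<lambda>_. s)}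
        (setm (2 * (n * n) + 2 * p + code (\<lambda>_. s)) 1 \<tau>3)" .
      have e4: "env (setm (2 * (n * n) + 2 * p + code (\<lambda>_. s)) 1 \<tau>3)"
        by (rule env_cong[OF e3]) simp
      show ?case
      proof (rule run_Seq[OF X(1)], unfold run_SetMem, rule run_Seq[OF X(1)], goal_cases)
        case 1
        have *: "eval_exp (Add (Reg 11) (Reg 12)) \<tau>3 = 2 * (n * n) + 2 * p + code (\<lambda>_. s)"
          using e3 by (simp add: env_def)
        show ?case
          unfolding * eval_exp.simps(1)
        proof (rule run_mono[OF run_sweeps[OF e4 r]], goal_cases)
          case (1 \<tau>4)
          note 0 = \<open>_ \<and> _ \<and> reg \<tau>1 16 + reg \<tau>1 17 = _ \<and> _\<close>
          have "code (\<lambda>_. t) < n ^ p" using t by (intro code_less) simp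
          then have "mem \<tau>4 (2 * (n * n) + 2 * p + code (\<lambda>_. t)) = of_bool (accepts (threshold T))"
            using 1 by (simp add: rep_def accepts_def)
          then show ?case using 0 1 2 4 e1 e2 e3
            by (intro run_If X(1)) (simp_all add: env_def rep_def trial_def max_def)
        qed
      qed
    qed (use e2 X in \<open>simp_all add: env_def\<close>)
  qed (use e1 X in \<open>simp_all add: env_def\<close>)
qed

lemma run_Codes:
  assumes regs: "reg \<sigma> 0 = p" "reg \<sigma> 1 = n" "reg \<sigma> 2 = s" "reg \<sigma> 3 = t"
  shows "run X Codes \<sigma> (\<lambda>\<tau>. reg \<tau> 5 = n ^ p \<and> reg \<tau> 12 = code (\<lambda>_. s) \<and> reg \<tau> 13 = code (\<lambda>_. t) \<and>
    (\<forall>r<12. r \<noteq> 5 \<longrightarrow> reg \<tau> r = reg \<sigma> r) \<and> mem \<tau> = mem \<sigma>)"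
  unfolding Codes_def
proof (intro run_Seq X(1), unfold run_SetReg, intro run_Seq X(1), unfold run_SetReg,
    intro run_Seq X(1), unfold run_SetReg, rule run_For[OF X(1), where N = p and
    I = "\<lambda>k \<tau>. reg \<tau> 5 = n ^ k \<and> reg \<tau> 12 = (\<Sum>j<k. s * n ^ j) \<and> reg \<tau> 13 = (\<Sum>j<k. t * n ^ j) \<and>
    (\<forall>r<12. r \<noteq> 5 \<longrightarrow> reg \<tau> r = reg \<sigma> r) \<and> mem \<tau> = mem \<sigma>"], goal_cases)
  case (5 k \<tau>)
  have b: "reg \<tau> 1 \<le> X" "reg \<tau> 2 \<le> X" "reg \<tau> 3 \<le> X" using 5 regs s t X by simp_all
  show ?case
    apply (rule run_Seq[OF X(1)], rule run_mono[OF run_Mul[OF X(1)]])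
    subgoal by simp
    subgoal by simp
    subgoal using b by simp
    apply (rule run_Seq[OF X(1)], unfold run_SetReg)
    apply (rule run_Seq[OF X(1)], rule run_mono[OF run_Mul[OF X(1)]])
    subgoal by simp
    subgoal by simp
    subgoal using b by simp
    apply (rule run_Seq[OF X(1)], unfold run_SetReg)
    apply (rule run_Seq[OF X(1)], rule run_mono[OF run_Mul[OF X(1)]])
    subgoal by simp
    subgoal by simp
    subgoal using b by simp
    subgoal using 5 regs by simp
    done
qed (use regs X in \<open>simp_all add: code_def\<close>)

lemma run_Setup:
  assumes regs: "reg \<sigma> 0 = p" "reg \<sigma> 1 = n" "reg \<sigma> 2 = s" "reg \<sigma> 3 = t"
    and C: "mem \<sigma> (n * n + (s * n + t)) = C" "W (s * n + t) = 0"
    and W: "\<And>c. c < n * n \<Longrightarrow> c \<noteq> s * n + t \<Longrightarrow> mem \<sigma> (n * n + c) = W c"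
  shows "run X Setup \<sigma> (\<lambda>\<tau>. env \<tau> \<and> weights \<tau> \<and> reg \<tau> 7 = C \<and> reg \<tau> 8 = 0)"
  unfolding Setup_def
  apply (rule run_Seq[OF X(1)], rule run_mono[OF run_Mul[OF X(1)]])
  subgoal by simp
  subgoal by simp
  subgoal using regs X by simp
  apply (rule run_Seq[OF X(1)], unfold run_SetReg)
  apply (rule run_Seq[OF X(1)], rule run_mono[OF run_Mul[OF X(1)]])
  subgoal by simp
  subgoal by simp
  subgoal using regs X by simp
  apply (rule run_Seq[OF X(1)], unfold run_SetReg)
  apply (rule run_Seq[OF X(1)], unfold run_SetMem)
  apply (rule run_Seq[OF X(1)], unfold run_SetReg)+
  apply (rule run_Seq[OF X(1)], rule run_mono[OF run_Codes])
  subgoal using regs by simp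
  subgoal using regs by simp
  subgoal using regs by simp
  subgoal using regs by simp
  apply (rule run_Seq[OF X(1)], rule run_mono[OF run_Mul[OF X(1)]])
  subgoal by simp
  subgoal by simp
  subgoal using X by simp
  apply (rule run_Seq[OF X(1)], unfold run_SetReg)
  subgoal for \<tau>1 \<tau>2 \<tau>3 \<tau>4
    using regs C W by (simp add: env_def weights_def)
  done

text \<open>\<open>W\<close> is the capacity matrix after the erasure of the arc from
  \<open>s\<close> to \<open>t\<close>, whereas the hypotheses describe the memory before it; hence
  the separate treatment of that cell.\<close>

theorem run_Solve:
  assumes regs: "reg \<sigma> 0 = p" "reg \<sigma> 1 = n" "reg \<sigma> 2 = s" "reg \<sigma> 3 = t"
    and C: "mem \<sigma> (n * n + (s * n + t)) = C" "W (s * n + t) = 0"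
    and W: "\<And>c. c < n * n \<Longrightarrow> c \<noteq> s * n + t \<Longrightarrow> mem \<sigma> (n * n + c) = W c"
  shows "run X Solve \<sigma> (\<lambda>\<tau>. reg \<tau> 0 = best C)"
  unfolding Solve_def
proof (rule run_Seq[OF X(1)], rule run_mono[OF run_Setup[OF regs C]], goal_cases)
  case (1 c)
  then show ?case by (rule W)
next
  case (2 \<tau>)
  note 1 = this
  show ?case
  proof (rule run_Seq[OF X(1)], rule run_For[OF X(1), where N = "n ^ p * n ^ p" and
      I = "\<lambda>k \<rho>. weights \<rho> \<and> reg \<rho> 8 = fold (trial C) [0..<k] 0 \<and> env \<rho> \<and> reg \<rho> 7 = C"], goal_cases)
    case (5 k \<rho>)
    then have "env \<rho>" "weights \<rho>" by simp_all
    from run_Trial[OF this 5(3,1)] show ?case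
    proof (rule run_mono)
      fix \<rho>' assume *: "weights \<rho>' \<and> reg \<rho>' 8 = trial (reg \<rho> 7) k (reg \<rho> 8) \<and>
        (\<forall>r<15. r \<noteq> 8 \<longrightarrow> reg \<rho>' r = reg \<rho> r)"
      have "env (setr 14 (Suc k) \<rho>')" by (rule env_cong[OF \<open>env \<rho>\<close>]) (use * in simp)
      with * 5 show "reg \<rho>' 14 = k \<and> reg \<rho>' 6 = n ^ p * n ^ p \<and> weights (setr 14 (Suc k) \<rho>') \<and>
        reg (setr 14 (Suc k) \<rho>') 8 = fold (trial C) [0..<Suc k] 0 \<and> env (setr 14 (Suc k) \<rho>') \<and>
        reg (setr 14 (Suc k) \<rho>') 7 = C"
        by (simp add: weights_def)
    qed
  next
    case 4
    have "env (setr 14 0 \<tau>)" by (rule env_cong[of \<tau>]) (use 1 in simp_all)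
    with 1 show ?case by (simp add: weights_def)
  qed (use 1 X in \<open>simp_all add: env_def best_def\<close>)
qed

end

section \<open>Correctness of the pebbling game\<close>

text \<open>Used to find the next vertex on a path. Its membership in the tail will exclude the
  starting vertex when the path is distinct.\<close>

lemma successively_next:
  "successively R xs \<Longrightarrow> x \<in> set xs \<Longrightarrow> x \<noteq> last xs \<Longrightarrow> \<exists>y\<in>set (tl xs). R x y"
  by (induction R xs rule: successively.induct) auto

context pebbling
begin

text \<open>Pebbles with threshold 0 are idle: they may jump to the sink and carry no path.\<close>

definition trail :: "nat \<Rightarrow> nat \<Rightarrow> nat list \<Rightarrow> bool" where
  "trail r v l \<longleftrightarrow> l \<noteq> [] \<and> hd l = s \<and> last l = v \<and> distinct l \<and> set l \<subseteq> {..<n} \<and>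
     successively (\<lambda>u v. r \<le> W (u * n + v)) l"

definition disjoint :: "(nat \<Rightarrow> nat) \<Rightarrow> (nat \<Rightarrow> nat list) \<Rightarrow> bool" where
  "disjoint \<theta> L \<longleftrightarrow> (\<forall>i<p. \<forall>j<p. i \<noteq> j \<longrightarrow> 0 < \<theta> i \<longrightarrow> 0 < \<theta> j \<longrightarrow>
     set (L i) \<inter> set (L j) \<subseteq> {s, t})"

definition linkage :: "(nat \<Rightarrow> nat) \<Rightarrow> (nat \<Rightarrow> nat list) \<Rightarrow> bool" where
  "linkage \<theta> L \<longleftrightarrow> (\<forall>i<p. 0 < \<theta> i \<longrightarrow> trail (\<theta> i) t (L i)) \<and> disjoint \<theta> L"

text \<open>The vertices that a pebble of positive threshold has left are processed. So a vertex
  outside \<open>F\<close> lies on its trail only if the pebble stands there.\<close>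

definition sound :: "(nat \<Rightarrow> nat) \<Rightarrow> nat set \<Rightarrow> nat \<Rightarrow> bool" where
  "sound \<theta> F S \<longleftrightarrow> S < n ^ p \<and> (\<exists>L. (\<forall>i<p. 0 < \<theta> i \<longrightarrow>
     trail (\<theta> i) (dig S i) (L i) \<and> set (butlast (L i)) \<subseteq> F - {t}) \<and> disjoint \<theta> L)"

definition pred_closed :: "nat set \<Rightarrow> bool" where
  "pred_closed F \<longleftrightarrow> F \<subseteq> {..<n} \<and> (\<forall>u\<in>F. ready F u)"

text \<open>The completeness invariant for a given linkage \<open>L\<close>: some position in the
  table has every pebble on its own path, beyond \<open>F\<close> or on \<open>t\<close>. Idle
  pebbles get the fictitious path straight from \<open>s\<close> to \<open>t\<close>.\<close>

definition covers :: "(nat \<Rightarrow> nat) \<Rightarrow> (nat \<Rightarrow> nat list) \<Rightarrow> nat set \<Rightarrow> nat set \<Rightarrow> bool" where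
  "covers \<theta> L F D \<longleftrightarrow> (\<exists>v. code v \<in> D \<and>
     (\<forall>i<p. v i \<in> set (if \<theta> i = 0 then [s, t] else L i) \<and> (v i = t \<or> v i \<notin> F)))"

section \<open>Soundness of the moves\<close>

lemma sound_mono: "sound \<theta> F S \<Longrightarrow> F \<subseteq> F' \<Longrightarrow> sound \<theta> F' S"
  unfolding sound_def by (meson Diff_mono subset_refl subset_trans)

text \<open>The core of the game: no arc of positive weight leads from the processed vertex into
  \<open>F\<close>, so no other pebble has left the target \<open>w\<close>, and \<open>free\<close>
  excludes that one stands on it. Thus \<open>w\<close> is on no other trail unless it is
  \<open>t\<close>.\<close>

lemma sound_shift:
  assumes snd: "sound \<theta> F S" and i: "i < p" and w: "w < n" and mv: "can_move \<theta> i S w"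
    and u: "dig S i \<in> F" "dig S i \<noteq> t"
    and F: "\<forall>w<n. W (dig S i * n + w) \<noteq> 0 \<longrightarrow> w \<notin> F"
  shows "sound \<theta> F (shift S i w)"
proof -
  from snd obtain L where S: "S < n ^ p" and L: "\<forall>i<p. 0 < \<theta> i \<longrightarrow>
     trail (\<theta> i) (dig S i) (L i) \<and> set (butlast (L i)) \<subseteq> F - {t}" and dis: "disjoint \<theta> L"
    unfolding sound_def by blast
  let ?L = "L(i := L i @ [w])"
  have set_L: "set (L j) \<subseteq> insert (dig S j) (F - {t})" if "j < p" "0 < \<theta> j" for j
  proof -
    have "L j = butlast (L j) @ [dig S j]"
      using L that unfolding trail_def by (metis append_butlast_last_id)
    then have "set (L j) = insert (dig S j) (set (butlast (L j)))"
      by (metis Un_insert_right list.set(1) list.simps(15) set_append sup_bot_right)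
    with L that show ?thesis by auto
  qed
  \<comment> \<open>A positive threshold forces the weight of the arc to be positive.\<close>
  have wF: "w \<notin> F" if "0 < \<theta> i"
    using F w mv that unfolding can_move_def by fastforce
  have "trail (\<theta> j) (dig (shift S i w) j) (?L j) \<and> set (butlast (?L j)) \<subseteq> F - {t}"
    if j: "j < p" "0 < \<theta> j" for j
  proof (cases "j = i")
    case True
    then have Li: "trail (\<theta> i) (dig S i) (L i)" "set (L i) \<subseteq> F - {t}"
      using L j set_L[of i] u by auto
    with True j wF w mv show ?thesis
      unfolding trail_def dig_shift[OF S i i w] True
      by (auto simp: successively_append_iff can_move_def)
  next
    case False
    with L j show ?thesis by (simp add: dig_shift[OF S i _ w])
  qed
  moreover have "disjoint \<theta> ?L"
  proof -
    have "set (L i @ [w]) \<inter> set (L j) \<subseteq> {s, t}" if "j < p" "j \<noteq> i" "0 < \<theta> i" "0 < \<theta> j" for j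
    proof -
      have "w \<in> set (L j) \<Longrightarrow> w = t"
        using set_L[OF that(1,4)] wF[OF that(3)] mv that(1) by (auto simp: can_move_def free_def)
      moreover have "set (L i) \<inter> set (L j) \<subseteq> {s, t}"
        using dis that i unfolding disjoint_def by blast
      ultimately show ?thesis by auto
    qed
    with dis show ?thesis unfolding disjoint_def by (auto simp: Int_commute)
  qed
  ultimately show ?thesis
    using shift_less[OF S i w] unfolding sound_def by blast
qed

lemma process_sound:
  assumes D: "\<forall>S\<in>D. sound \<theta> F S" and u: "u \<in> F" "u \<noteq> t"
    and F: "\<forall>w<n. W (u * n + w) \<noteq> 0 \<longrightarrow> w \<notin> F"
  shows "\<forall>S\<in>process \<theta> u D. sound \<theta> F S"
  unfolding process_def
proof (rule fold_invariant[where P = "\<lambda>D. \<forall>S\<in>D. sound \<theta> F S" and Q = "\<lambda>i. i < p"])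
  fix i D assume i: "i < p" and D: "\<forall>S\<in>D. sound \<theta> F S"
  show "\<forall>S\<in>fold (advance \<theta> u i) [0..<n ^ p] D. sound \<theta> F S"
  proof (rule fold_invariant[where P = "\<lambda>D. \<forall>S\<in>D. sound \<theta> F S" and Q = "\<lambda>_. True"])
    fix S D assume "\<forall>S\<in>D. sound \<theta> F S"
    then show "\<forall>S\<in>advance \<theta> u i S D. sound \<theta> F S"
      using i u F by (auto simp: advance_def moves_def intro!: sound_shift)
  qed (use D in auto)
qed (use D in auto)

lemma subset_fold:
  assumes "\<And>x D. D \<subseteq> f x D"
  shows "D \<subseteq> fold f xs (D :: 'b set)"
  using assms by (induction xs arbitrary: D) (simp, metis fold_simps(2) order_trans)

lemma subset_fold_advance: "D \<subseteq> fold (advance \<theta> u i) xs D"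
  by (rule subset_fold) (auto simp: advance_def)

text \<open>The scan splits at \<open>S\<close>: the code is still in the table when its turn comes,
  and what it adds is never removed.\<close>

lemma moves_subset_fold_advance:
  assumes "S \<in> D" "S < n ^ p" "dig S i = u"
  shows "moves \<theta> i S n \<subseteq> fold (advance \<theta> u i) [0..<n ^ p] D"
proof -
  have "[0..<n ^ p] = [0..<S] @ S # [Suc S..<n ^ p]"
    using assms(2) upt_add_eq_append[of 0 S "n ^ p - S"] upt_conv_Cons[of S "n ^ p"] by simp
  moreover have "S \<in> fold (advance \<theta> u i) [0..<S] D"
    using assms(1) subset_fold_advance by blast
  then have "moves \<theta> i S n \<subseteq> advance \<theta> u i S (fold (advance \<theta> u i) [0..<S] D)"
    using assms(3) by (auto simp: advance_def)
  ultimately show ?thesis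
    using subset_fold_advance by (simp add: order_trans)
qed

end

section \<open>Completeness in acyclic graphs\<close>

locale acyclic_pebbling = pebbling +
  assumes s_neq_t: "s \<noteq> t"
    and acyc: "acyclic {(u, v). u < n \<and> v < n \<and> W (u * n + v) \<noteq> 0}"
begin

lemma no_loop: "u < n \<Longrightarrow> W (u * n + u) = 0"
  using acyc unfolding acyclic_def by blast

text \<open>An arc from \<open>u\<close> into \<open>F\<close> would put its tail \<open>u\<close>
  into the predecessor-closed set \<open>F\<close>; a loop at \<open>u\<close> is excluded by
  acyclicity.\<close>

lemma ready_no_back_arc:
  assumes "pred_closed F" "u < n" "u \<notin> F" "w < n" "W (u * n + w) \<noteq> 0"
  shows "w \<notin> insert u F"
proof -
  have "w \<noteq> u" using assms no_loop[of u] by auto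
  moreover have "w \<notin> F"
  proof
    assume "w \<in> F"
    then have "ready F w" using assms(1) by (simp add: pred_closed_def)
    with assms(2,5) have "u \<in> F" by (simp add: ready_def)
    with assms(3) show False by contradiction
  qed
  ultimately show ?thesis by simp
qed

lemma process_complete:
  assumes L: "linkage \<theta> L" and c: "covers \<theta> L F D"
    and F: "pred_closed F" "u < n" "u \<notin> F" and u: "u \<noteq> t"
  shows "covers \<theta> L (insert u F) (process \<theta> u D)"
proof -
  let ?L = "\<lambda>i. if \<theta> i = 0 then [s, t] else L i"
  have L_less: "x < n" if "x \<in> set (?L i)" "i < p" for i x
    using that L s t unfolding linkage_def trail_def by (auto split: if_splits)
  \<comment> \<open>Induction on \<open>k\<close>: the pebbles below \<open>k\<close> are off
    \<open>u\<close>. Several pebbles can share \<open>u\<close> when \<open>u = s\<close>, so they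
    leave one after the other.\<close>
  have "\<exists>v. code v \<in> fold (\<lambda>i. fold (advance \<theta> u i) [0..<n ^ p]) [0..<k] D \<and>
     (\<forall>i<p. v i \<in> set (?L i) \<and> (v i = t \<or> v i \<notin> F) \<and> (i < k \<longrightarrow> v i \<noteq> u))" if "k \<le> p" for k
    using that
  proof (induction k)
    case 0
    then show ?case using c unfolding covers_def by simp
  next
    case (Suc k)
    then have k: "k < p" by simp
    let ?D = "fold (\<lambda>i. fold (advance \<theta> u i) [0..<n ^ p]) [0..<k] D"
    from Suc obtain v where vD: "code v \<in> ?D"
      and v: "\<forall>i<p. v i \<in> set (?L i) \<and> (v i = t \<or> v i \<notin> F) \<and> (i < k \<longrightarrow> v i \<noteq> u)"
      by auto
    have v_less: "\<forall>i<p. v i < n" using v L_less by blast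
    show ?case
    proof (cases "v k = u")
      case False
      with v vD show ?thesis
        using subset_fold_advance[of ?D \<theta> u k "[0..<n ^ p]"]
        by (intro exI[of _ v]) (auto simp: less_Suc_eq)
    next
      case True
      \<comment> \<open>The pebble moves to a successor of \<open>u\<close> on its own path.\<close>
      have "\<exists>w\<in>set (tl (?L k)). \<theta> k \<le> W (u * n + w)"
      proof (rule successively_next[where R = "\<lambda>u v. \<theta> k \<le> W (u * n + v)"])
        show "successively (\<lambda>u v. \<theta> k \<le> W (u * n + v)) (?L k)"
          using L k by (simp add: linkage_def trail_def)
        show "u \<in> set (?L k)" using v k True by blast
        show "u \<noteq> last (?L k)" using L k u by (simp add: linkage_def trail_def)
      qed
      then obtain w where w: "w \<in> set (tl (?L k))" "\<theta> k \<le> W (u * n + w)" by blast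
      then have wL: "w \<in> set (?L k)" by (cases "L k") (auto split: if_splits)
      then have wn: "w < n" using k L_less by blast
      have ws: "w \<noteq> s"
      proof (cases "\<theta> k = 0")
        case False
        then have "L k \<noteq> []" "hd (L k) = s" "distinct (L k)"
          using L k by (simp_all add: linkage_def trail_def)
        then have "s \<notin> set (tl (L k))" by (metis distinct.simps(2) list.collapse)
        with w False show ?thesis by auto
      qed (use w s_neq_t in auto)
      \<comment> \<open>An idle pebble jumps to \<open>t\<close>; for any other the arc has positive
        weight, so that \<open>w\<close> is not yet processed.\<close>
      have w': "w = t \<or> 0 < \<theta> k \<and> w \<notin> insert u F"
        using w(1,2) ready_no_back_arc[OF F wn] by (cases "\<theta> k = 0") auto
      \<comment> \<open>Another pebble on \<open>w\<close> would put \<open>w\<close> on two paths,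
        which share at most \<open>s\<close> and \<open>t\<close>.\<close>
      have "v j \<noteq> w" if "j < p" "w \<noteq> t" for j
      proof (cases "j = k")
        case True
        with w' \<open>v k = u\<close> that show ?thesis by auto
      next
        case False
        have "set (?L j) \<inter> set (?L k) \<subseteq> {s, t}"
          using L False that k by (auto simp: linkage_def disjoint_def)
        with wL ws that v show ?thesis by blast
      qed
      then have "can_move \<theta> k (code v) w"
        using w True by (auto simp: can_move_def free_def dig_code[OF v_less] k)
      then have "shift (code v) k w \<in> moves \<theta> k (code v) n" using wn by (auto simp: moves_def)
      then have "shift (code v) k w \<in> fold (advance \<theta> u k) [0..<n ^ p] ?D"
        using moves_subset_fold_advance[OF vD code_less[OF v_less], of k u \<theta>] True
        by (auto simp: dig_code[OF v_less k])
      moreover have "shift (code v) k w = code (v(k := w))"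
        by (simp add: shift_def code_upd k dig_code[OF v_less k])
      ultimately have "code (v(k := w)) \<in> fold (\<lambda>i. fold (advance \<theta> u i) [0..<n ^ p]) [0..<Suc k] D"
        by simp
      moreover have "(v(k := w)) i \<in> set (?L i) \<and> ((v(k := w)) i = t \<or> (v(k := w)) i \<notin> F) \<and>
          (i < Suc k \<longrightarrow> (v(k := w)) i \<noteq> u)" if "i < p" for i
        using v w' wL u that by (cases "i = k") auto
      ultimately show ?thesis by blast
    qed
  qed
  from this[of p] obtain v where "code v \<in> process \<theta> u D"
    "\<forall>i<p. v i \<in> set (?L i) \<and> (v i = t \<or> v i \<notin> F) \<and> v i \<noteq> u"
    unfolding process_def by auto
  then show ?thesis unfolding covers_def by (intro exI[of _ v]) blast
qed

definition invariant :: "(nat \<Rightarrow> nat) \<Rightarrow> nat set \<times> nat set \<Rightarrow> bool" where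
  "invariant \<theta> FD \<longleftrightarrow> pred_closed (fst FD) \<and> (\<forall>S\<in>snd FD. sound \<theta> (fst FD) S) \<and>
     (\<forall>L. linkage \<theta> L \<longrightarrow> covers \<theta> L (fst FD) (snd FD))"

text \<open>The vertex joins \<open>F\<close> before its pebbles move, since \<open>sound\<close>
  wants abandoned vertices in \<open>F\<close>. For \<open>u = t\<close> the table is unchanged, and
  \<open>covers\<close> tolerates pebbles on \<open>t\<close>.\<close>

lemma inv_peel:
  assumes "invariant \<theta> FD" "u < n"
  shows "invariant \<theta> (peel \<theta> u FD)"
proof (cases "u \<notin> fst FD \<and> ready (fst FD) u")
  case True
  then have u: "u \<notin> fst FD" "ready (fst FD) u" by auto
  let ?F = "insert u (fst FD)"
  have cl: "pred_closed (fst FD)" and snd: "\<forall>S\<in>snd FD. sound \<theta> ?F S"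
    and com: "\<And>L. linkage \<theta> L \<Longrightarrow> covers \<theta> L (fst FD) (snd FD)"
    using assms by (auto simp: invariant_def intro: sound_mono)
  have "pred_closed ?F" using cl u assms(2) unfolding pred_closed_def ready_def by blast
  moreover have "\<forall>S\<in>process \<theta> u (snd FD). sound \<theta> ?F S" if "u \<noteq> t"
    using that snd ready_no_back_arc[OF cl assms(2) u(1)] by (intro process_sound) blast+
  moreover have "covers \<theta> L ?F (process \<theta> u (snd FD))" if "u \<noteq> t" "linkage \<theta> L" for L
    using process_complete[OF that(2) com[OF that(2)] cl assms(2) u(1) that(1)] .
  moreover have "covers \<theta> L ?F (snd FD)" if "u = t" "linkage \<theta> L" for L
    using com[OF that(2)] that(1) unfolding covers_def by blast
  ultimately show ?thesis using True snd by (cases "u = t") (simp_all add: peel_def invariant_def)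
qed (use assms in \<open>auto simp: peel_def\<close>)

lemma inv_init: "invariant \<theta> ({}, {code (\<lambda>_. s)})"
proof -
  have "trail (\<theta> i) (dig (code (\<lambda>_. s)) i) [s]" if "i < p" for i
    using that s by (simp add: trail_def dig_code)
  then have "sound \<theta> {} (code (\<lambda>_. s))"
    unfolding sound_def using s
    by (intro conjI code_less exI[of _ "\<lambda>_. [s]"]) (auto simp: disjoint_def)
  moreover have "covers \<theta> L {} {code (\<lambda>_. s)}" if "linkage \<theta> L" for L
    unfolding covers_def using that by (intro exI[of _ "\<lambda>_. s"]) (auto simp: linkage_def trail_def)
  ultimately show ?thesis by (simp add: invariant_def pred_closed_def)
qed

section \<open>Exhaustion of the vertices by sweeps\<close>

lemma inv_fold_peel: "invariant \<theta> FD \<Longrightarrow> invariant \<theta> (fold (peel \<theta>) [0..<n] FD)"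
  by (rule fold_invariant[where Q = "\<lambda>u. u < n"]) (auto intro: inv_peel)

lemma subset_fold_peel: "fst FD \<subseteq> fst (fold (peel \<theta>) us FD)"
proof (induction us arbitrary: FD)
  case (Cons u us)
  have "fst FD \<subseteq> fst (peel \<theta> u FD)" by (auto simp: peel_def)
  with Cons[of "peel \<theta> u FD"] show ?case by simp
qed simp

text \<open>Readiness persists when \<open>F\<close> grows, so \<open>u\<close> is peeled at its
  turn at the latest.\<close>

lemma fold_peel_progress:
  assumes "ready (fst FD) u" "u < n"
  shows "u \<in> fst (fold (peel \<theta>) [0..<n] FD)"
proof -
  have "[0..<n] = [0..<u] @ u # [Suc u..<n]"
    using assms(2) upt_add_eq_append[of 0 u "n - u"] upt_conv_Cons[of u n] by simp
  moreover have "ready (fst (fold (peel \<theta>) [0..<u] FD)) u"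
    using assms(1) subset_fold_peel unfolding ready_def by blast
  then have "u \<in> fst (peel \<theta> u (fold (peel \<theta>) [0..<u] FD))" by (auto simp: peel_def)
  moreover from this have "u \<in> fst (fold (peel \<theta>) [Suc u..<n] (peel \<theta> u (fold (peel \<theta>) [0..<u] FD)))"
    using subset_fold_peel by blast
  ultimately show ?thesis by simp
qed

text \<open>The witness is a minimal vertex outside \<open>F\<close> for the arc relation, which is
  well-founded as it is finite and acyclic.\<close>

lemma ex_ready:
  assumes "pred_closed F" "F \<noteq> {..<n}"
  shows "\<exists>u<n. u \<notin> F \<and> ready F u"
proof -
  let ?E = "{(u, v). u < n \<and> v < n \<and> W (u * n + v) \<noteq> 0}"
  have "finite ?E" by (rule finite_subset[of _ "{..<n} \<times> {..<n}"]) auto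
  then have "wf ?E" using acyc by (rule finite_acyclic_wf)
  moreover from assms obtain x where "x \<in> {..<n} - F" unfolding pred_closed_def by blast
  ultimately obtain u where "u \<in> {..<n} - F" "\<And>v. (v, u) \<in> ?E \<Longrightarrow> v \<notin> {..<n} - F"
    by (rule wfE_min) blast
  then show ?thesis unfolding ready_def by blast
qed

lemma sweeps_correct: "invariant \<theta> (sweeps \<theta>)" "fst (sweeps \<theta>) = {..<n}"
proof -
  let ?FD = "\<lambda>k. fold (\<lambda>_. fold (peel \<theta>) [0..<n]) [0..<k] ({}, {code (\<lambda>_. s)})"
  \<comment> \<open>Each sweep that starts with an unmarked vertex marks at least one, so
    \<open>n\<close> sweeps suffice.\<close>
  have *: "invariant \<theta> (?FD k) \<and> (fst (?FD k) = {..<n} \<or> k \<le> card (fst (?FD k)))" for k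
  proof (induction k)
    case 0
    show ?case by (simp add: inv_init)
  next
    case (Suc k)
    let ?F = "fst (?FD k)" and ?F' = "fst (?FD (Suc k))"
    have inv: "invariant \<theta> (?FD (Suc k))" using Suc inv_fold_peel by simp
    then have sub: "?F' \<subseteq> {..<n}" unfolding invariant_def pred_closed_def by blast
    have mono: "?F \<subseteq> ?F'" using subset_fold_peel by simp
    show ?case
    proof (cases "?F = {..<n}")
      case True
      with sub mono inv show ?thesis by blast
    next
      case False
      with Suc obtain u where "u < n" "u \<notin> ?F" "ready ?F u"
        using ex_ready unfolding invariant_def by blast
      with fold_peel_progress have "u \<in> ?F'" by simp
      with mono \<open>u \<notin> ?F\<close> have "?F \<subset> ?F'" by blast
      moreover have "finite ?F'" using sub finite_subset by blast
      ultimately have "card ?F < card ?F'" by (rule psubset_card_mono[rotated])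
      with Suc False inv show ?thesis by simp
    qed
  qed
  from *[of n] show "invariant \<theta> (sweeps \<theta>)" by (simp add: sweeps_def)
  then have "fst (sweeps \<theta>) \<subseteq> {..<n}" unfolding invariant_def pred_closed_def by blast
  with *[of n] show "fst (sweeps \<theta>) = {..<n}"
    by (metis card_lessThan card_seteq finite_lessThan sweeps_def)
qed

text \<open>Once all vertices are in \<open>F\<close>, soundness of the final code provides a
  linkage, and conversely \<open>covers\<close> leaves no place but \<open>t\<close> for any
  pebble.\<close>

lemma accepts_iff: "accepts \<theta> \<longleftrightarrow> (\<exists>L. linkage \<theta> L)"
proof
  assume "accepts \<theta>"
  then have "sound \<theta> {..<n} (code (\<lambda>_. t))"
    using sweeps_correct[of \<theta>] by (auto simp: accepts_def invariant_def)
  then show "\<exists>L. linkage \<theta> L" using t by (auto simp: sound_def linkage_def dig_code)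
next
  assume "\<exists>L. linkage \<theta> L"
  then obtain L where L: "linkage \<theta> L" ..
  then obtain v where v: "code v \<in> snd (sweeps \<theta>)"
    "\<forall>i<p. v i \<in> set (if \<theta> i = 0 then [s, t] else L i) \<and> (v i = t \<or> v i \<notin> {..<n})"
    using sweeps_correct[of \<theta>] unfolding invariant_def covers_def by metis
  have "v i = t" if "i < p" for i
  proof -
    have "set (if \<theta> i = 0 then [s, t] else L i) \<subseteq> {..<n}"
      using L that s t by (simp add: linkage_def trail_def)
    with v(2) that show ?thesis by blast
  qed
  then have "code v = code (\<lambda>_. t)" by (simp add: code_def)
  with v(1) show "accepts \<theta>" by (simp add: accepts_def)
qed

text \<open>The first alternative is the initial value of the fold, for the case that no trial is
  accepted.\<close>

lemma best_cases:
  "best C = 0 \<or> (\<exists>\<theta> L. linkage \<theta> L \<and> best C = total C \<theta>)"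
proof -
  have "fold (trial C) [0..<k] 0 = 0 \<or> (\<exists>\<theta> L. linkage \<theta> L \<and> fold (trial C) [0..<k] 0 = total C \<theta>)" for k
    by (induction k) (auto simp: trial_def max_def accepts_iff)
  then show ?thesis by (simp add: best_def)
qed

lemma best_ge:
  assumes L: "linkage \<theta> L" and \<theta>: "\<forall>i<p. \<exists>c<n * n. \<theta> i = W c"
  shows "total C \<theta> \<le> best C"
proof -
  from \<theta> obtain c where c: "\<forall>i<p. c i < n * n" "\<forall>i<p. \<theta> i = W (c i)" by metis
  \<comment> \<open>The coding lemmas are reused in base \<open>n * n\<close> to turn the choice of
    cells into a trial number; the source and sink 0 are dummies.\<close>
  interpret sq: pebbling "n * n" p 0 0 W by unfold_locales (use s in auto)
  let ?T = "sq.code c"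
  have less: "?T < n ^ p * n ^ p" using sq.code_less[OF c(1)] by (simp add: power_mult_distrib)
  have eq: "threshold ?T i = \<theta> i" if "i < p" for i
    using sq.dig_code[OF c(1) that] c(2) that by (simp add: threshold_def sq.dig_def)
  have "linkage (threshold ?T) L" using L eq by (simp add: linkage_def disjoint_def)
  then have acc: "accepts (threshold ?T)" using accepts_iff by blast
  have "(\<Sum>i<p. threshold ?T i) = (\<Sum>i<p. \<theta> i)" using eq by simp
  then have tot: "total C (threshold ?T) = total C \<theta>" using eq by (auto simp: total_def)
  have "total C (threshold T) \<le> fold (trial C) [0..<k] 0" if "T < k" "accepts (threshold T)" for T k
    using that by (induction k) (auto simp: trial_def less_Suc_eq)
  from this[OF less acc] show ?thesis by (simp add: best_def tot)
qed

end

section \<open>Vertex-decomposable flows\<close>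

lemma pawalk_verts_not_Nil [simp]: "pawalk_verts u P \<noteq> []"
  by (cases P) auto

lemma pcas_hd_last:
  "pcas u P v \<Longrightarrow> hd (pawalk_verts u P) = u \<and> last (pawalk_verts u P) = v"
  by (induction P arbitrary: u) auto

lemma vwalk_arcs_pawalk_verts: "pcas u P v \<Longrightarrow> vwalk_arcs (pawalk_verts u P) = P"
proof (induction P arbitrary: u)
  case (Cons a P)
  then show ?case by (cases P) (auto simp: prod_eq_iff)
qed simp

lemma pawalk_vwalk_arcs:
  "l \<noteq> [] \<Longrightarrow> pcas (hd l) (vwalk_arcs l) (last l) \<and> pawalk_verts (hd l) (vwalk_arcs l) = l"
  by (induction l rule: vwalk_arcs.induct) auto

lemma successively_vwalk_arcs:
  "successively R l \<longleftrightarrow> (\<forall>(u, v)\<in>set (vwalk_arcs l). R u v)"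
  by (induction l rule: vwalk_arcs.induct) auto

lemma vwalk_arcs_endpoints:
  "(u, v) \<in> set (vwalk_arcs l) \<Longrightarrow> u \<in> set l \<and> v \<in> set l \<and> v \<in> set (tl l)"
  by (induction l rule: vwalk_arcs.induct) auto

lemma vwalk_arcs_not_into_hd: "distinct l \<Longrightarrow> (u, hd l) \<notin> set (vwalk_arcs l)"
  using vwalk_arcs_endpoints[of u "hd l" l] by (cases l) auto

lemma distinct_vwalk_arcs: "distinct l \<Longrightarrow> distinct (vwalk_arcs l)"
  by (induction l rule: vwalk_arcs.induct) (auto dest: vwalk_arcs_endpoints)

text \<open>The first vertex of a distinct list has only one outgoing arc, so the second vertex is
  already the last.\<close>

lemma direct_walk:
  assumes "distinct l" "(hd l, last l) \<in> set (vwalk_arcs l)"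
  shows "l = [hd l, last l]"
  using assms
proof (induction l rule: vwalk_arcs.induct)
  case (3 x y l)
  then have "y = last (y # l)"
    using vwalk_arcs_endpoints[of x "last (y # l)" "y # l"] by auto
  with 3(2) have "l = []" by (metis distinct.simps(2) last.simps last_in_set)
  then show ?case by simp
qed auto

text \<open>The sums telescope along the walk.\<close>

lemma vwalk_arcs_balance:
  "l \<noteq> [] \<Longrightarrow> (\<Sum>a\<leftarrow>vwalk_arcs l. of_bool (fst a = x)) - (\<Sum>a\<leftarrow>vwalk_arcs l. of_bool (snd a = x)) =
     (of_bool (hd l = x) - of_bool (last l = x) :: int)"
proof (induction l rule: vwalk_arcs.induct)
  case (3 a b l)
  have "last (a # b # l) = last (b # l)" by simp
  with 3 show ?case
    unfolding vwalk_arcs.simps list.map sum_list.Cons list.sel fst_conv snd_conv by simp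
qed simp_all

lemma st_path_iff:
  "st_path N P \<longleftrightarrow> source N \<in> pverts (dgraph N) \<and> set P \<subseteq> parcs (dgraph N) \<and>
     pcas (source N) P (sink N) \<and> distinct (pawalk_verts (source N) P)"
  by (simp add: st_path_def pre_digraph.apath_def pre_digraph.awalk_def cas_with_proj_eq
      awalk_verts_with_proj_eq)

lemma internal_verts_eq:
  "internal_verts N P = set (pawalk_verts (source N) P) - {source N, sink N}"
  by (simp add: internal_verts_def awalk_verts_with_proj_eq)

lemma balance_sum:
  assumes "\<forall>a\<in>parcs (dgraph N). x a = (\<Sum>i\<in>I. y i a)"
  shows "balance N x v = (\<Sum>i\<in>I. balance N (y i) v)"
proof -
  have "(\<Sum>a\<in>A. int (x a)) = (\<Sum>i\<in>I. \<Sum>a\<in>A. int (y i a))" if "A \<subseteq> parcs (dgraph N)" for A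
  proof -
    have "(\<Sum>a\<in>A. int (x a)) = (\<Sum>a\<in>A. \<Sum>i\<in>I. int (y i a))"
      using assms that by (intro sum.cong) (auto simp: subset_iff)
    also have "\<dots> = (\<Sum>i\<in>I. \<Sum>a\<in>A. int (y i a))" by (rule sum.swap)
    finally show ?thesis .
  qed
  moreover have "out_arcs (with_proj (dgraph N)) v \<subseteq> parcs (dgraph N)"
    "in_arcs (with_proj (dgraph N)) v \<subseteq> parcs (dgraph N)" by auto
  ultimately show ?thesis by (simp add: balance_def sum_subtractf)
qed

section \<open>The game instance of a network\<close>

locale acyclic_flow_network =
  fixes N :: "nat network" and n p :: nat
  assumes network: "flow_network N" and acyclic: "acyclic_network N"
    and verts: "pverts (dgraph N) = {0..<n}"
begin

abbreviation "G \<equiv> dgraph N"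
abbreviation "s \<equiv> source N"
abbreviation "t \<equiv> sink N"

definition weight :: "nat \<Rightarrow> nat" where
  "weight c = (let a = (c div n, c mod n) in if a \<in> parcs G \<and> a \<noteq> (s, t) then cap N a else 0)"

definition direct :: nat where
  "direct = (if (s, t) \<in> parcs G then cap N (s, t) else 0)"

lemma graph: "pair_digraph G"
  and s_less: "s < n" and t_less: "t < n" and s_neq_t: "s \<noteq> t"
  using network verts by (auto simp: flow_network_def)

lemma arcs_less: "(u, v) \<in> parcs G \<Longrightarrow> u < n \<and> v < n \<and> u \<noteq> v"
  using pair_wf_digraph.in_arcsD1[of G u v] pair_wf_digraph.in_arcsD2[of G u v]
    pair_loopfree_digraph.pair_no_loops[of G "(u, v)"] graph verts
  by (auto simp: pair_digraph_def pair_fin_digraph_def)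

lemma finite_arcs: "finite (parcs G)"
  using graph by (simp add: pair_digraph_def pair_fin_digraph.pair_finite_arcs)

lemma weight_cell:
  "u < n \<Longrightarrow> v < n \<Longrightarrow> weight (u * n + v) = (if (u, v) \<in> parcs G \<and> (u, v) \<noteq> (s, t) then cap N (u, v) else 0)"
  by (simp add: weight_def Let_def)

lemma weight_pos:
  "u < n \<Longrightarrow> v < n \<Longrightarrow> weight (u * n + v) \<noteq> 0 \<Longrightarrow>
    (u, v) \<in> parcs G \<and> (u, v) \<noteq> (s, t) \<and> weight (u * n + v) = cap N (u, v)"
  by (auto simp: weight_cell split: if_splits)

sublocale pebbling: acyclic_pebbling n p s t weight
proof
  have "{(u, v). u < n \<and> v < n \<and> weight (u * n + v) \<noteq> 0} \<subseteq> parcs G"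
    using weight_pos by auto
  with acyclic show "Transitive_Closure.acyclic {(u, v). u < n \<and> v < n \<and> weight (u * n + v) \<noteq> 0}"
    unfolding acyclic_network_def by (rule acyclic_subset)
qed (use s_less t_less s_neq_t in auto)

text \<open>As the path is distinct, each of its arcs counts once, and telescoping leaves only the
  end points.\<close>

lemma path_flow_balance:
  assumes P: "st_path N P" and y: "\<forall>a\<in>parcs G. y a = (if a \<in> set P then r else 0)"
  shows "balance N y v = int r * (of_bool (v = s) - of_bool (v = t))"
proof -
  let ?l = "pawalk_verts s P"
  have P': "set P \<subseteq> parcs G" "pcas s P t" "distinct ?l" using P by (simp_all add: st_path_iff)
  have arcs: "vwalk_arcs ?l = P" using P'(2) by (rule vwalk_arcs_pawalk_verts)
  have ends: "hd ?l = s" "last ?l = t" "?l \<noteq> []"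
    using pcas_hd_last[OF P'(2)] by simp_all
  have "(\<Sum>a\<in>{a \<in> parcs G. g a = v}. int (y a)) = int r * (\<Sum>a\<leftarrow>P. of_bool (g a = v))" for g
  proof -
    have "(\<Sum>a\<in>{a \<in> parcs G. g a = v}. int (y a)) =
        (\<Sum>a\<in>parcs G. if a \<in> set P then int r * of_bool (g a = v) else 0)"
      unfolding sum.inter_filter[OF finite_arcs] using y by (intro sum.cong) auto
    also have "\<dots> = (\<Sum>a\<in>set P. int r * of_bool (g a = v))"
      using P'(1) finite_arcs by (simp add: sum.If_cases Int_absorb1)
    also have "\<dots> = int r * (\<Sum>a\<leftarrow>P. of_bool (g a = v))"
      using distinct_vwalk_arcs[OF P'(3)] arcs
      by (simp add: sum_list_distinct_conv_sum_set sum_distrib_left)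
    finally show ?thesis .
  qed
  then have "balance N y v = int r * ((\<Sum>a\<leftarrow>P. of_bool (fst a = v)) - (\<Sum>a\<leftarrow>P. of_bool (snd a = v)))"
    by (simp add: balance_def out_arcs_def in_arcs_def right_diff_distrib)
  also have "\<dots> = int r * (of_bool (v = s) - of_bool (v = t))"
    using vwalk_arcs_balance[OF ends(3), of v] ends arcs by (simp add: eq_commute)
  finally show ?thesis .
qed

text \<open>Arc-disjointness is demanded separately since the arc from \<open>s\<close> to
  \<open>t\<close> has no internal vertices. It lets at most one path contribute to each arc, so
  capacities are respected.\<close>

lemma family_of_paths:
  assumes I: "finite I" "card I \<le> p"
    and P: "\<And>i. i \<in> I \<Longrightarrow> st_path N (P i)" "\<And>i a. i \<in> I \<Longrightarrow> a \<in> set (P i) \<Longrightarrow> r i \<le> cap N a"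
    and disj: "\<And>i j. i \<in> I \<Longrightarrow> j \<in> I \<Longrightarrow> i \<noteq> j \<Longrightarrow> internal_verts N (P i) \<inter> internal_verts N (P j) = {}"
    and arc: "\<And>i j a. i \<in> I \<Longrightarrow> j \<in> I \<Longrightarrow> a \<in> set (P i) \<Longrightarrow> a \<in> set (P j) \<Longrightarrow> i = j"
  shows "\<exists>x. is_flow N x \<and> vertex_decomposable N p x \<and> flow_value N x = int (\<Sum>i\<in>I. r i)"
proof -
  define y where "y i a = (if a \<in> set (P i) then r i else 0)" for i a
  define x where "x a = (\<Sum>i\<in>I. y i a)" for a
  have bal_y: "balance N (y i) v = int (r i) * (of_bool (v = s) - of_bool (v = t))" if "i \<in> I" for i v
    using P(1)[OF that] by (intro path_flow_balance) (auto simp: y_def)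
  then have bal: "balance N x v = (\<Sum>i\<in>I. int (r i) * (of_bool (v = s) - of_bool (v = t)))" for v
    by (subst balance_sum[where I = I and y = y]) (auto simp: x_def)
  have "x a \<le> cap N a" for a
  proof (cases "\<exists>i\<in>I. a \<in> set (P i)")
    case True
    then obtain i where i: "i \<in> I" "a \<in> set (P i)" by blast
    then have "x a = (\<Sum>j\<in>I. if j = i then r i else 0)"
      unfolding x_def y_def using arc by (intro sum.cong) auto
    with i I P(2) show ?thesis by simp
  next
    case False
    then have "x a = 0" unfolding x_def y_def by (intro sum.neutral) auto
    then show ?thesis by simp
  qed
  then have flow: "is_flow N x" by (simp add: is_flow_def bal)
  have "path_flow_along N (P i) (y i)" if "i \<in> I" for i
    unfolding path_flow_along_def is_flow_def
    using that P by (auto simp: bal_y y_def intro!: exI[of _ "r i"])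
  \<comment> \<open>\<open>vertex_decomposable\<close> numbers its paths from 0, so \<open>I\<close>
    is enumerated.\<close>
  moreover obtain h where h: "bij_betw h {..<card I} I"
    using I(1) bij_betw_from_nat_into_finite by blast
  moreover from this have "h i \<in> I" if "i < card I" for i
    using that by (auto simp: bij_betw_def)
  moreover from this have "internal_verts N (P (h i)) \<inter> internal_verts N (P (h j)) = {}"
    if "i < card I" "j < card I" "i \<noteq> j" for i j
    using that h disj[of "h i" "h j"] by (auto simp: bij_betw_def inj_on_def)
  moreover have "x a = (\<Sum>i<card I. y (h i) a)" for a
    unfolding x_def using sum.reindex_bij_betw[OF h, of "\<lambda>i. y i a"] by simp
  ultimately have "vertex_decomposable N p x"
    unfolding vertex_decomposable_def using I(2)
    by (intro exI[of _ "card I"] conjI exI[of _ "P \<circ> h"] exI[of _ "y \<circ> h"]) simp_all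
  moreover have "flow_value N x = int (\<Sum>i\<in>I. r i)"
    using s_neq_t by (simp add: flow_value_def bal)
  ultimately show ?thesis using flow by blast
qed

section \<open>Optimality of the computed value\<close>

lemma best_attained:
  "\<exists>x. is_flow N x \<and> vertex_decomposable N p x \<and> flow_value N x = int (pebbling.best direct)"
  using pebbling.best_cases[of direct]
proof (elim disjE exE conjE)
  assume "pebbling.best direct = 0"
  with family_of_paths[of "{}"] show ?thesis by simp
next
  fix \<theta> L assume 2: "pebbling.linkage \<theta> L" "pebbling.best direct = pebbling.total direct \<theta>"
    define J where "J = {i. i < p \<and> 0 < \<theta> i}"
    let ?P = "\<lambda>i. vwalk_arcs (L i)"
    have L: "L i \<noteq> []" "hd (L i) = s" "last (L i) = t" "distinct (L i)" "set (L i) \<subseteq> {..<n}"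
      "successively (\<lambda>u v. \<theta> i \<le> weight (u * n + v)) (L i)" if "i \<in> J" for i
      using 2(1) that by (simp_all add: J_def pebbling.linkage_def pebbling.trail_def)
    have arcs: "a \<in> parcs G \<and> a \<noteq> (s, t) \<and> \<theta> i \<le> cap N a" if "i \<in> J" "a \<in> set (?P i)" for i a
    proof -
      obtain u v where a: "a = (u, v)" by (cases a)
      have "u < n" "v < n"
        using L(5)[OF that(1)] vwalk_arcs_endpoints[of u v "L i"] that(2) a by auto
      moreover have "\<theta> i \<le> weight (u * n + v)"
        using L(6)[OF that(1)] that(2) a by (auto simp: successively_vwalk_arcs)
      moreover have "0 < \<theta> i" using that by (simp add: J_def)
      ultimately show ?thesis using weight_pos[of u v] a by auto
    qed
    have path: "st_path N (?P i)" "pawalk_verts s (?P i) = L i" if "i \<in> J" for i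
      using pawalk_vwalk_arcs[OF L(1)[OF that]] L(2-4)[OF that] arcs[OF that] s_less verts
      by (auto simp: st_path_iff)
    have disj: "set (L i) \<inter> set (L j) \<subseteq> {s, t}" if "i \<in> J" "j \<in> J" "i \<noteq> j" for i j
      using 2(1) that by (auto simp: J_def pebbling.linkage_def pebbling.disjoint_def)
    \<comment> \<open>A common arc would have both ends in \<open>{s, t}\<close>. As no arc of a
      path enters \<open>s\<close>, it would be the arc from \<open>s\<close> to \<open>t\<close>,
      which has been erased.\<close>
    have arc: "i = j" if ij: "i \<in> J" "j \<in> J" and a: "a \<in> set (?P i)" "a \<in> set (?P j)" for i j a
    proof (rule ccontr)
      assume "i \<noteq> j"
      obtain u v where uv: "a = (u, v)" by (cases a)
      have "u \<in> set (L k) \<and> v \<in> set (L k)" if "k \<in> J" "a \<in> set (?P k)" for k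
        using vwalk_arcs_endpoints[of u v "L k"] that uv by auto
      with ij a have "u \<in> {s, t}" "v \<in> {s, t}" using disj[OF ij \<open>i \<noteq> j\<close>] by blast+
      moreover have "v \<noteq> s" using vwalk_arcs_not_into_hd[OF L(4)[OF ij(1)]] a(1) uv L(2)[OF ij(1)] by auto
      moreover have "u \<noteq> v" "a \<noteq> (s, t)" using arcs[OF ij(1) a(1)] arcs_less uv by auto
      ultimately show False using uv by auto
    qed
    have internal: "internal_verts N (?P i) \<inter> internal_verts N (?P j) = {}"
      if "i \<in> J" "j \<in> J" "i \<noteq> j" for i j
      using disj[OF that] path(2) that by (auto simp: internal_verts_eq)
    have sumJ: "(\<Sum>i\<in>J. \<theta> i) = (\<Sum>i<p. \<theta> i)"
      unfolding J_def by (intro sum.mono_neutral_left) auto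
    have finJ: "finite J" "J \<subseteq> {..<p}" by (auto simp: J_def)
    show ?thesis
    proof (cases "(\<exists>k<p. \<theta> k = 0) \<and> direct \<noteq> 0")
      case False
      then have "pebbling.best direct = (\<Sum>i\<in>J. \<theta> i)"
        by (auto simp: 2(2) pebbling.total_def sumJ)
      moreover have "card J \<le> p" using finJ by (metis card_lessThan card_mono finite_lessThan)
      then have "\<exists>x. is_flow N x \<and> vertex_decomposable N p x \<and> flow_value N x = int (\<Sum>i\<in>J. \<theta> i)"
        using finJ(1) path(1) arcs arc internal by (intro family_of_paths[of J ?P]) auto
      ultimately show ?thesis by simp
    next
      case True
      \<comment> \<open>The idle pebble \<open>k\<close> is outside \<open>J\<close> and provides
        the index for the erased arc as an additional path.\<close>
      then obtain k where k: "k < p" "\<theta> k = 0" by blast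
      then have kJ: "k \<notin> J" by (simp add: J_def)
      have st: "(s, t) \<in> parcs G" "direct = cap N (s, t)"
        using True by (auto simp: direct_def split: if_splits)
      let ?P' = "?P(k := [(s, t)])" and ?r = "\<theta>(k := direct)"
      have 1: "st_path N [(s, t)]" using st s_neq_t s_less verts by (simp add: st_path_iff)
      have "\<exists>x. is_flow N x \<and> vertex_decomposable N p x \<and>
          flow_value N x = int (\<Sum>i\<in>insert k J. ?r i)"
      proof (rule family_of_paths[where P = ?P'])
        have "insert k J \<subseteq> {..<p}" using k finJ by auto
        then show "card (insert k J) \<le> p" by (metis card_lessThan card_mono finite_lessThan)
      next
        fix i j assume "i \<in> insert k J" "j \<in> insert k J" "i \<noteq> j"
        then show "internal_verts N (?P' i) \<inter> internal_verts N (?P' j) = {}"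
          using internal by (auto simp: internal_verts_eq[of _ "[(s, t)]"])
      next
        fix i j a assume "i \<in> insert k J" "j \<in> insert k J" "a \<in> set (?P' i)" "a \<in> set (?P' j)"
        then show "i = j"
          using arc[of i j a] arcs[of i a] arcs[of j a] by (auto split: if_splits)
      qed (use finJ path arcs 1 st in \<open>auto split: if_splits\<close>)
      moreover have "(\<Sum>i\<in>insert k J. ?r i) = pebbling.best direct"
      proof -
        have "(\<Sum>i\<in>J. ?r i) = (\<Sum>i\<in>J. \<theta> i)" using kJ by (intro sum.cong) auto
        then show ?thesis using kJ finJ k by (auto simp: 2(2) pebbling.total_def sumJ)
      qed
      ultimately show ?thesis by (simp only:)
  qed
qed

lemma best_upper_bound:
  assumes flow: "is_flow N x" and dec: "vertex_decomposable N p x"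
  shows "flow_value N x \<le> int (pebbling.best direct)"
proof -
  from dec obtain q P y where q: "q \<le> p" and pf: "\<forall>i<q. path_flow_along N (P i) (y i)"
    and disj: "\<forall>i<q. \<forall>j<q. i \<noteq> j \<longrightarrow> internal_verts N (P i) \<inter> internal_verts N (P j) = {}"
    and x: "\<forall>a\<in>parcs G. x a = (\<Sum>i<q. y i a)"
    unfolding vertex_decomposable_def by blast
  from pf obtain r where r: "\<forall>i<q. \<forall>a\<in>parcs G. y i a = (if a \<in> set (P i) then r i else 0)"
    unfolding path_flow_along_def by metis
  have path: "st_path N (P i)" "is_flow N (y i)" if "i < q" for i
    using pf that by (auto simp: path_flow_along_def)
  let ?L = "\<lambda>i. pawalk_verts s (P i)"
  have L: "set (P i) \<subseteq> parcs G" "pcas s (P i) t" "distinct (?L i)" "vwalk_arcs (?L i) = P i"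
    "hd (?L i) = s" "last (?L i) = t" if "i < q" for i
    using path(1)[OF that] pcas_hd_last[of s "P i" t] vwalk_arcs_pawalk_verts[of s "P i" t]
    by (simp_all add: st_path_iff)
  have L_less: "set (?L i) \<subseteq> {..<n}" if "i < q" for i
  proof -
    have "set (pawalk_verts u Q) \<subseteq> {..<n}" if "u < n" "set Q \<subseteq> parcs G" for u Q
      using that
    proof (induction Q arbitrary: u)
      case (Cons a Q)
      then have "fst a < n" "snd a < n" using arcs_less[of "fst a" "snd a"] by auto
      with Cons.IH[of "snd a"] Cons.prems show ?case by simp
    qed simp
    from this[OF s_less] L(1)[OF that] show ?thesis .
  qed
  have r_le: "r i \<le> cap N a" if "i < q" "a \<in> set (P i)" for i a
    using path(2)[OF that(1)] r L(1)[OF that(1)] that by (force simp: is_flow_def)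
  have val: "flow_value N x = (\<Sum>i<q. int (r i))"
  proof -
    have "balance N (y i) s = int (r i)" if "i < q" for i
      using path_flow_balance[OF path(1)[OF that], of "y i" "r i" s] r that s_neq_t by simp
    then show ?thesis unfolding flow_value_def by (simp add: balance_sum[OF x])
  qed
  \<comment> \<open>\<open>J\<close> collects the useful paths that the game can draw,
    \<open>B\<close> those consisting of the erased arc. Several indices may be in \<open>B\<close>,
    as this arc has no internal vertices.\<close>
  define J where "J = {i. i < q \<and> 0 < r i \<and> P i \<noteq> [(s, t)]}"
  define B where "B = {i. i < q \<and> P i = [(s, t)]}"
  have weight_P: "weight (u * n + v) = cap N (u, v)" if "i \<in> J" "(u, v) \<in> set (P i)" for i u v
  proof -
    have i: "i < q" "P i \<noteq> [(s, t)]" using that by (auto simp: J_def)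
    have "(u, v) \<noteq> (s, t)"
    proof
      assume "(u, v) = (s, t)"
      then have "?L i = [s, t]" using direct_walk[OF L(3)[OF i(1)]] L[OF i(1)] that(2) by metis
      with L(4)[OF i(1)] i(2) show False by simp
    qed
    moreover have "(u, v) \<in> parcs G" using L(1)[OF i(1)] that(2) by blast
    ultimately show ?thesis using arcs_less weight_cell by auto
  qed
  \<comment> \<open>The cell is that of an arc of least capacity on the path; the path remains
    feasible when its value is raised to this capacity.\<close>
  have "\<exists>c<n * n. r i \<le> weight c \<and> (\<forall>(u, v)\<in>set (P i). weight c \<le> weight (u * n + v))"
    if i: "i \<in> J" for i
  proof -
    have iq: "i < q" using i by (simp add: J_def)
    have "P i \<noteq> []" using L(2)[OF iq] s_neq_t by auto
    then obtain a where a: "a \<in> set (P i)" "\<forall>b\<in>set (P i). cap N a \<le> cap N b"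
      using ex_min_if_finite[of "cap N ` set (P i)"] by (auto simp: not_less)
    obtain u v where uv: "a = (u, v)" by (cases a)
    have "u < n" "v < n" using arcs_less L(1)[OF iq] a(1) uv by auto
    moreover have "weight (u * n + v) = cap N a" using weight_P[OF i] a(1) uv by simp
    ultimately show ?thesis
      using a r_le[OF iq a(1)] weight_P[OF i] cell_less[of u n v]
      by (intro exI[of _ "u * n + v"]) auto
  qed
  then obtain c where c: "\<And>i. i \<in> J \<Longrightarrow> c i < n * n" "\<And>i. i \<in> J \<Longrightarrow> r i \<le> weight (c i)"
    "\<And>i. i \<in> J \<Longrightarrow> \<forall>(u, v)\<in>set (P i). weight (c i) \<le> weight (u * n + v)"
    by metis
  define \<theta> where "\<theta> i = (if i \<in> J then weight (c i) else 0)" for i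
  have "pebbling.linkage \<theta> ?L"
    unfolding pebbling.linkage_def
  proof (intro conjI allI impI)
    fix i assume "0 < \<theta> i"
    then have i: "i \<in> J" "i < q" "\<theta> i = weight (c i)" by (auto simp: \<theta>_def J_def split: if_splits)
    show "pebbling.trail (\<theta> i) t (?L i)"
      unfolding pebbling.trail_def successively_vwalk_arcs i(3)
      using L[OF i(2)] L_less[OF i(2)] c(3)[OF i(1)] by simp
  next
    show "pebbling.disjoint \<theta> ?L"
      unfolding pebbling.disjoint_def
    proof (intro allI impI)
      fix i j assume "i \<noteq> j" "0 < \<theta> i" "0 < \<theta> j"
      then have "i < q" "j < q" by (auto simp: \<theta>_def J_def split: if_splits)
      with disj \<open>i \<noteq> j\<close> show "set (?L i) \<inter> set (?L j) \<subseteq> {s, t}"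
        by (auto simp: internal_verts_eq)
    qed
  qed
  moreover have "\<forall>i<p. \<exists>c<n * n. \<theta> i = weight c"
  proof (intro allI impI)
    fix i
    \<comment> \<open>The threshold 0 of the indices outside \<open>J\<close> is found in cell 0,
      which belongs to the impossible loop at vertex 0.\<close>
    have "weight 0 = 0" using weight_cell[of 0 0] arcs_less[of 0 0] s_less by auto
    moreover have "0 < n * n" using s_less by simp
    ultimately show "\<exists>c<n * n. \<theta> i = weight c"
      using c(1)[of i] unfolding \<theta>_def by metis
  qed
  ultimately have best: "pebbling.total direct \<theta> \<le> pebbling.best direct"
    by (rule pebbling.best_ge)
  have fin: "finite J" "finite B" by (auto simp: J_def B_def)
  have "(\<Sum>i<q. r i) = (\<Sum>i\<in>J \<union> B. r i)"
    by (rule sum.mono_neutral_right) (auto simp: J_def B_def)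
  also have "\<dots> = (\<Sum>i\<in>J. r i) + (\<Sum>i\<in>B. r i)"
    using fin by (intro sum.union_disjoint) (auto simp: J_def B_def)
  also have "(\<Sum>i\<in>J. r i) \<le> (\<Sum>i<p. \<theta> i)"
  proof -
    have "(\<Sum>i\<in>J. r i) \<le> (\<Sum>i\<in>J. \<theta> i)" using c(2) by (intro sum_mono) (simp add: \<theta>_def)
    also have "\<dots> \<le> (\<Sum>i<p. \<theta> i)" using q by (intro sum_mono2) (auto simp: J_def)
    finally show ?thesis .
  qed
  also have "(\<Sum>i\<in>B. r i) \<le> (if \<exists>i<p. \<theta> i = 0 then direct else 0)"
  proof (cases "B = {}")
    case False
    then obtain k where k: "k < q" "P k = [(s, t)]" by (auto simp: B_def)
    \<comment> \<open>A path-flow on the erased arc occupies an index of threshold 0, so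
      \<open>total\<close> does add \<open>direct\<close>.\<close>
    then have "k < p" "\<theta> k = 0" using q by (auto simp: \<theta>_def J_def)
    moreover have st: "(s, t) \<in> parcs G" using L(1)[OF k(1)] k(2) by simp
    \<comment> \<open>Together the path-flows in \<open>B\<close> are bounded by the flow
      \<open>x\<close> on the arc from \<open>s\<close> to \<open>t\<close>, hence by its
      capacity.\<close>
    have "(\<Sum>i\<in>B. r i) \<le> direct"
    proof -
      have "(\<Sum>i\<in>B. r i) = (\<Sum>i\<in>B. y i (s, t))"
        using r st by (intro sum.cong) (auto simp: B_def)
      also have "\<dots> \<le> (\<Sum>i<q. y i (s, t))" by (intro sum_mono2) (auto simp: B_def)
      also have "\<dots> \<le> direct" using x st flow by (auto simp: direct_def is_flow_def)
      finally show ?thesis .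
    qed
    ultimately show ?thesis by auto
  qed simp
  finally have "(\<Sum>i<q. r i) \<le> pebbling.total direct \<theta>" by (simp add: pebbling.total_def)
  with best have "(\<Sum>i<q. r i) \<le> pebbling.best direct" by linarith
  then show ?thesis unfolding val by (simp flip: of_nat_sum)
qed

section \<open>Running time in terms of the number of vertices\<close>

lemma solve_network:
  "\<exists>k \<tau>. exec Solve (input_state N p) k \<tau> \<and>
     vertex_decomposable_max_flow N p (int (reg \<tau> 0)) \<and>
     k \<le> factor Solve * n ^ (2 * depth Solve * (p + 1))"
proof -
  \<comment> \<open>A common bound for all loops. The exponent is \<open>2 * (p + 1)\<close> and not
    \<open>2 * p\<close> so that \<open>n \<le> ?X\<close> also holds for
    \<open>p = 0\<close>.\<close>
  let ?X = "n ^ (2 * (p + 1))"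
  have n: "2 \<le> n" using s_less t_less s_neq_t by linarith
  have le: "n ^ i \<le> ?X" if "i \<le> 2 * (p + 1)" for i
    using that n by (intro power_increasing) auto
  \<comment> \<open>Loops over the pebbles make \<open>p\<close> iterations, so \<open>p\<close>
    must be bounded by a power of \<open>n\<close> as well; \<open>2 \<le> n\<close> holds as source
    and sink differ.\<close>
  have "p \<le> 2 ^ p" by (rule less_imp_le[OF less_exp])
  also have "\<dots> \<le> n ^ p" using n by (rule power_mono) simp
  finally have p: "p \<le> n ^ p" .
  interpret pebbling_run n p s t weight ?X
  proof
    show "1 \<le> ?X" using n by simp
    show "n \<le> ?X" using le[of 1] by simp
    show "n ^ p \<le> ?X" by (rule le) simp
    with p show "p \<le> ?X" by linarith
    have "n ^ p * n ^ p = n ^ (2 * p)" by (simp add: mult_2 power_add)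
    with le[of "2 * p"] show "n ^ p * n ^ p \<le> ?X" by simp
  qed
  have card: "card (pverts G) = n" using verts by simp
  have cell: "mem (input_state N p) (n * n + c) =
      (if (c div n, c mod n) \<in> parcs G then cap N (c div n, c mod n) else 0)" if "c < n * n" for c
    using that by (simp add: input_state_def card Let_def)
  have "run ?X Solve (input_state N p) (\<lambda>\<tau>. reg \<tau> 0 = pebbling.best direct)"
  proof (rule run_Solve)
    have "s * n + t < n * n" using s_less t_less by (rule cell_less)
    then show "mem (input_state N p) (n * n + (s * n + t)) = direct"
      using cell[of "s * n + t"] t_less by (simp add: direct_def)
    show "weight (s * n + t) = 0" using s_less t_less by (simp add: weight_cell)
    fix c assume c: "c < n * n" "c \<noteq> s * n + t"
    then have "(c div n, c mod n) \<noteq> (s, t)" by (metis div_mult_mod_eq prod.inject)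
    then show "mem (input_state N p) (n * n + c) = weight c"
      using cell[OF c(1)] by (simp add: weight_def Let_def)
  qed (simp_all add: input_state_def card Let_def)
  then obtain k \<tau> where *: "exec Solve (input_state N p) k \<tau>" "reg \<tau> 0 = pebbling.best direct"
    "k \<le> factor Solve * ?X ^ depth Solve"
    unfolding run_def by blast
  have "?X ^ depth Solve = n ^ (2 * depth Solve * (p + 1))"
    by (simp only: power_mult[symmetric] mult_ac)
  with *(3) have "k \<le> factor Solve * n ^ (2 * depth Solve * (p + 1))" by (simp only:)
  moreover have "vertex_decomposable_max_flow N p (int (reg \<tau> 0))"
    unfolding vertex_decomposable_max_flow_def *(2) using best_attained best_upper_bound by blast
  ultimately show ?thesis using *(1) by blast
qed

end

text \<open>The machine has no multiplication, but \<open>m\<close> is fixed, so the product is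
  written out as an \<open>m\<close>-fold sum.\<close>

lemma computable_linear: "computable (\<lambda>k. m * (k + 1))"
proof -
  have "\<exists>e. \<forall>\<sigma>. eval_exp e \<sigma> = m * (reg \<sigma> 0 + 1)"
  proof (induction m)
    case 0
    show ?case by (intro exI[of _ "Num 0"]) simp
  next
    case (Suc m)
    then obtain e where "\<forall>\<sigma>. eval_exp e \<sigma> = m * (reg \<sigma> 0 + 1)" ..
    then show ?case by (intro exI[of _ "Add (Add (Reg 0) (Num 1)) e"]) simp
  qed
  then obtain e where "\<forall>\<sigma>. eval_exp e \<sigma> = m * (reg \<sigma> 0 + 1)" ..
  then show ?thesis
    unfolding computable_def
    by (intro exI[of _ "SetReg 0 e"] allI) (rule exI, rule exI, rule conjI, rule exec.SetReg, simp)
qed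

theorem theorem6p7:
  shows "\<exists>f :: nat \<Rightarrow> nat. computable f \<and>
    (\<exists>(c :: prog) (C :: nat). \<forall>(N :: nat network) (n :: nat) (p :: nat).
       flow_network N \<and> acyclic_network N \<and> pverts (dgraph N) = {0..<n} \<longrightarrow>
       (\<exists>k \<tau>. exec c (input_state N p) k \<tau> \<and>
              vertex_decomposable_max_flow N p (int (reg \<tau> 0)) \<and>
              k \<le> C * n ^ f p))"
  \<comment> \<open>\<open>Solve\<close> and its \<open>factor\<close> depend neither on the network
    nor on \<open>p\<close>, and the exponent is linear in \<open>p\<close>.\<close>
  using computable_linear acyclic_flow_network.solve_network[unfolded acyclic_flow_network_def]
  by (intro exI[of _ "\<lambda>p. 2 * depth Solve * (p + 1)"] conjI exI[of _ Solve] exI[of _ "factor Solve"])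
    blast+

end
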